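(* Let $N$ and $M$ be $\mathbb K$-matroids with respective underlying sets $S$ and $T$, where $\mathbb K$ is the Krasner hyperfield. A submonomial matrix $\Phi$ indexed by $T\times S$ with entries in $\mathbb K$ is a morphism $\Phi:N\to M$ of $\mathbb K$-matroids if and only if $\underline\Phi:\underline N\to\underline M$ is a strong map. In particular, for any perfect idyll $F$ and any $F$-morphism $\Phi:N\to M$ of $F$-matroids with respective underlying sets $S$ and $T$, the underlying map $\underline\Phi:\underline S\to\underline T$ is a strong map $\underline\Phi:\underline N\to\underline M$ between the underlying matroids.
   Context: An idyll is a commutative multiplicative monoid $F$ with an element $0$ satisfying $0\cdot a=0$ for all $a$ and such that $F^\times=F\setminus\{0\}$ is an abelian group, together with a subset $N_F$ (the nullset) of the group semiring $\mathbb N[F^\times]$ (where $0\in F$ is identified with the empty sum) such that $0\in N_F$, $1\notin N_F$, $N_F+N_F\subseteq N_F$, $\mathbb N[F^\times]\cdot N_F\subseteq N_F$, and there is a unique element $-1\in F^\times$ with $1+(-1)\in N_F$. The Krasner hyperfield is the (perfect) idyll $\mathbb K=\{0,1\}$ with $N_{\mathbb K}=\mathbb N\setminus\{1\}\subseteq\mathbb N=\mathbb N[\mathbb K^\times]$. Let $E$ be a finite set and $r\ge 0$. A Grassmann-Plücker function of rank $r$ on $E$ with coefficients in $F$ is a nonzero function $\varphi:E^r\to F$ that is alternating (i.e. $\varphi(x_{\sigma(1)},\dots,x_{\sigma(r)})=\mathrm{sign}(\sigma)\varphi(x_1,\dots,x_r)$ for all permutations $\sigma$, and $\varphi(x_1,\dots,x_r)=0$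 if the $x_i$ are not pairwise distinct) and satisfies $\sum_{k=0}^r(-1)^k\varphi(y_0,\dots,\widehat{y_k},\dots,y_r)\varphi(y_k,x_2,\dots,x_r)\in N_F$ for all $x_2,\dots,x_r,y_0,\dots,y_r\in E$. An $F$-matroid of rank $r$ on $E$ is a class $M=[\varphi]$ of such functions up to multiplication by elements of $F^\times$. Its underlying matroid $\underline M$ is the (ordinary) matroid on $E$ with bases $\{x_1,\dots,x_r\}$ for $\varphi(x_1,\dots,x_r)\neq0$. Dual: fix a total order on $E$ and let $n=\#E$; $M^*=[\varphi^*]$ with $\varphi^*:E^{n-r}\to F$, $\varphi^*(x)=0$ if $x$ has repeated entries, and $\varphi^*(x)=\mathrm{sign}(x,x')\varphi(x')$ otherwise, where $x'\in E^r$ lists the complement of the entries of $x$ and $\mathrm{sign}(x,x')\in\{\pm1\}$ is the sign of the permutation sorting $(x,x')$. Circuits: $\mathcal C_M\subseteq F^E$ consists of all $aX_y$ with $a\in F^\times$ and $y=(y_0,\dots,y_r)\in E^{r+1}$ with distinct entries and $\varphi(y_0,\dots,\widehat{y_k},\dots,y_r)\ne0$ for some $k$, where $X_y(y_i)=(-1)^i\varphi(y_0,\dots,\widehat{y_i},\dots,y_r)$ and $X_y(x)=0$ for other $x$. Cocircuits: $\mathcal C_M^*=\mathcal C_{M^*}$. For $X,Y\in F^E$ write $X\perp Y$ if $\sum_{e}X_eY_e\in N_F$. Vectors: $\mathcal V_M=\{X\in F^E: X\perp Y\ \forall Y\in\mathcal C_M^*\}$. Covectors: $\mathcal V_M^*=\{X\in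 F^E:X\perp Y\ \forall Y\in\mathcal C_M\}$. The idyll $F$ is perfect if $X\perp Y$ for all $F$-matroids $M$, $X\in\mathcal V_M$, $Y\in\mathcal V_M^*$. A submonomial $F$-matrix indexed by $T\times S$ (finite sets) is a matrix $\Phi=(\Phi_{i,j})_{(i,j)\in T\times S}$ with entries in $F$ such that each row and each column has at most one nonzero entry; it defines a map $F^S\to F^T$, $(\Phi\cdot X)_i=\sum_{j}\Phi_{i,j}X_j$ (at most one nonzero term). For $F$-matroids $N$ on $S$ and $M$ on $T$ ($F$ a perfect idyll), an $F$-morphism $\Phi:N\to M$ is a submonomial $F$-matrix indexed by $T\times S$ with $\Phi\cdot\mathcal V_N\subseteq\mathcal V_M$. For a set $S$, $\underline S=S\sqcup\{0\}$ is the pointed set with base point $0$. The underlying map $\underline\Phi:\underline S\to\underline T$ of $\Phi$ is given by $\underline\Phi(j)=i$ if $j\in S$ and $\Phi_{i,j}\ne0$, and $\underline\Phi(j)=0$ if $j=0$ or $\Phi_{i,j}=0$ for all $i\in T$. For ordinary matroids $N$ on $S$ and $M$ on $T$, let $\widetilde N$, $\widetilde M$ be the matroids on $\underline S$, $\underline T$ obtained by adding $0$ as a loop. A strong map $\sigma:N\to M$ is a base point preserving map $\sigma:\underline S\to\underline T$ such that $\sigma^{-1}(A)$ is a flat of $\widetilde N$ for every flat $A$ of $\widetilde M$. *)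

theory Defs
  imports "HOL-Library.Multiset" "HOL-Combinatorics.Permutations"
begin

section \<open>Idylls\<close>

text \<open>
  An element of the group semiring \<open>\<nat>[F\<^sup>\<times>]\<close> is a finite formal sum of nonzero elements
  of \<open>F\<close>; it is represented by the finite multiset of its summands.  Addition of formal sums
  is then addition of multisets, and multiplication is the following convolution.
\<close>

definition (in times) formal_times :: "'a multiset \<Rightarrow> 'a multiset \<Rightarrow> 'a multiset" where
  "formal_times A B = (\<Sum>a\<in>#A. image_mset (\<lambda>b. a * b) B)"

text \<open>
  The zero of \<open>F\<close> is identified with the empty sum, so zero terms are dropped.
\<close>

definition formal_elem :: "'a::zero \<Rightarrow> 'a multiset" where
  "formal_elem a = (if a = 0 then {#} else {#a#})"

definition formal_sum :: "('i \<Rightarrow> 'a::zero) \<Rightarrow> 'i set \<Rightarrow> 'a multiset" where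
  "formal_sum f I = (\<Sum>i\<in>I. formal_elem (f i))"

class idyll = comm_monoid_mult + mult_zero + zero_neq_one +
  fixes nullset :: "'a multiset set"
  assumes unit_inverse: "a \<noteq> 0 \<Longrightarrow> \<exists>b. a * b = 1"
    and nullset_nonzero: "A \<in> nullset \<Longrightarrow> 0 \<notin># A"
    and nullset_zero: "{#} \<in> nullset"
    and nullset_one: "{#1#} \<notin> nullset"
    and nullset_plus: "A \<in> nullset \<Longrightarrow> B \<in> nullset \<Longrightarrow> A + B \<in> nullset"
    and nullset_times: "0 \<notin># A \<Longrightarrow> B \<in> nullset \<Longrightarrow> formal_times A B \<in> nullset"
    and nullset_neg_one: "\<exists>!e. e \<noteq> 0 \<and> {#1, e#} \<in> nullset"

definition neg_one :: "'f::idyll" where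
  "neg_one = (THE e. e \<noteq> 0 \<and> {#1, e#} \<in> nullset)"

definition of_sign :: "int \<Rightarrow> 'f::idyll" where
  "of_sign s = (if s = 1 then 1 else neg_one)"

datatype krasner = Zero_K | One_K

instantiation krasner :: "{comm_monoid_mult, mult_zero, zero_neq_one}"
begin

definition "0 = Zero_K"
definition "1 = One_K"
definition "a * b = (if a = One_K \<and> b = One_K then One_K else Zero_K)"

instance
proof
  fix a b c :: krasner
  show "a * b * c = a * (b * c)" "a * b = b * a" "1 * a = a" "0 * a = 0" "a * 0 = 0"
    by (cases a; cases b; simp add: zero_krasner_def one_krasner_def times_krasner_def)+
  show "(0::krasner) \<noteq> 1"
    by (simp add: zero_krasner_def one_krasner_def)
qed

end

instantiation krasner :: idyll
begin

definition "nullset = {A :: krasner multiset. 0 \<notin># A \<and> size A \<noteq> 1}"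

instance
proof
  fix a :: krasner and A B :: "krasner multiset"
  show "\<exists>b. a * b = 1" if "a \<noteq> 0"
    using that by (cases a) (auto simp: zero_krasner_def one_krasner_def times_krasner_def)
  show "0 \<notin># A" if "A \<in> nullset"
    using that by (simp add: nullset_krasner_def)
  show "{#} \<in> (nullset :: krasner multiset set)" "{#1#} \<notin> (nullset :: krasner multiset set)"
    by (simp_all add: nullset_krasner_def)
  show "A + B \<in> nullset" if "A \<in> nullset" "B \<in> nullset"
    using that by (auto simp: nullset_krasner_def)
  show "formal_times A B \<in> nullset" if "0 \<notin># A" "B \<in> nullset"
  proof -
    have "0 \<notin># formal_times A B"
    proof
      assume "0 \<in># formal_times A B"
      then obtain a b where "a \<in># A" "b \<in># B" "a * b = 0"
        by (auto simp: formal_times_def)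
      then have "a = 0 \<or> b = 0"
        by (cases a; cases b; simp add: zero_krasner_def times_krasner_def)
      with \<open>a \<in># A\<close> \<open>b \<in># B\<close> that show False
        by (auto simp: nullset_krasner_def)
    qed
    moreover have "size (formal_times A B) = size A * size B"
      unfolding formal_times_def by (induction A) auto
    then have "size (formal_times A B) \<noteq> 1"
      using that by (simp add: nullset_krasner_def)
    ultimately show ?thesis
      by (simp add: nullset_krasner_def)
  qed
  show "\<exists>!e::krasner. e \<noteq> 0 \<and> {#1, e#} \<in> nullset"
  proof
    show "(1::krasner) \<noteq> 0 \<and> {#1, 1::krasner#} \<in> nullset"
      by (simp add: nullset_krasner_def zero_krasner_def one_krasner_def)
    show "e = 1" if "e \<noteq> 0 \<and> {#1, e#} \<in> nullset" for e :: krasner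
      using that by (cases e) (auto simp: zero_krasner_def one_krasner_def)
  qed
qed

end


section \<open>Matroids with coefficients\<close>

text \<open>Tuples in \<open>E\<^sup>r\<close> are lists of length \<open>r\<close>; entries are indexed from 0.\<close>

definition tuples :: "'e set \<Rightarrow> nat \<Rightarrow> 'e list set" where
  "tuples E r = {xs. length xs = r \<and> set xs \<subseteq> E}"

definition omit :: "nat \<Rightarrow> 'e list \<Rightarrow> 'e list" where
  "omit k ys = take k ys @ drop (Suc k) ys"

text \<open>
  A function on \<open>E\<^sup>r\<close> is extended by 0 to all lists.  The list \<open>xs\<close> in the last condition
  stands for \<open>(x\<^sub>2, \<dots>, x\<^sub>r)\<close>, so that condition is empty for \<open>r = 0\<close>.
\<close>

definition grassmann_pluecker :: "'e set \<Rightarrow> nat \<Rightarrow> ('e list \<Rightarrow> 'f::idyll) \<Rightarrow> bool" where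
  "grassmann_pluecker E r \<phi> \<longleftrightarrow>
     (\<forall>xs. xs \<notin> tuples E r \<longrightarrow> \<phi> xs = 0) \<and>
     (\<exists>xs. \<phi> xs \<noteq> 0) \<and>
     (\<forall>xs\<in>tuples E r. \<forall>\<sigma>. \<sigma> permutes {..<r} \<longrightarrow>
        \<phi> (permute_list \<sigma> xs) = of_sign (sign \<sigma>) * \<phi> xs) \<and>
     (\<forall>xs\<in>tuples E r. \<not> distinct xs \<longrightarrow> \<phi> xs = 0) \<and>
     (\<forall>xs ys. Suc (length xs) = r \<and> set xs \<subseteq> E \<and> ys \<in> tuples E (Suc r) \<longrightarrow>
        formal_sum (\<lambda>k. neg_one ^ k * \<phi> (omit k ys) * \<phi> (ys ! k # xs)) {0..r} \<in> nullset)"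

text \<open>
  The last field is a class of Grassmann-Pluecker functions modulo multiplication by units.
\<close>

record ('e, 'f) fmatroid =
  ground :: "'e set"
  frank :: nat
  gp_class :: "('e list \<Rightarrow> 'f) set"

definition is_fmatroid :: "('e, 'f::idyll) fmatroid \<Rightarrow> bool" where
  "is_fmatroid M \<longleftrightarrow> finite (ground M) \<and>
     (\<exists>\<phi>. grassmann_pluecker (ground M) (frank M) \<phi> \<and>
          gp_class M = {\<lambda>xs. a * \<phi> xs | a. a \<noteq> 0})"

text \<open>
  A total order on a finite set, given by the list of its elements in increasing order.
  The order is an arbitrary fixed one; changing it multiplies the dual Grassmann-Pluecker
  functions by a sign.
\<close>

definition fixed_order :: "'e set \<Rightarrow> 'e list" where
  "fixed_order E = (SOME es. distinct es \<and> set es = E)"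

definition sorting_sign :: "'e list \<Rightarrow> 'e list \<Rightarrow> int" where
  "sorting_sign es zs =
     sign (THE p. p permutes {..<length zs} \<and> permute_list p zs = es)"

definition dual_gp :: "'e set \<Rightarrow> nat \<Rightarrow> ('e list \<Rightarrow> 'f::idyll) \<Rightarrow> 'e list \<Rightarrow> 'f" where
  "dual_gp E r \<phi> xs =
     (if xs \<in> tuples E (card E - r) \<and> distinct xs
      then let xs' = filter (\<lambda>e. e \<notin> set xs) (fixed_order E)
           in of_sign (sorting_sign (fixed_order E) (xs @ xs')) * \<phi> xs'
      else 0)"

definition dual :: "('e, 'f::idyll) fmatroid \<Rightarrow> ('e, 'f) fmatroid" where
  "dual M = \<lparr>ground = ground M, frank = card (ground M) - frank M,
             gp_class = dual_gp (ground M) (frank M) ` gp_class M\<rparr>"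

text \<open>Elements of \<open>F\<^sup>E\<close> are likewise extended by 0.\<close>

definition tuple_space :: "'e set \<Rightarrow> ('e \<Rightarrow> 'f::zero) set" where
  "tuple_space E = {X. \<forall>e. e \<notin> E \<longrightarrow> X e = 0}"

definition circuits :: "('e, 'f::idyll) fmatroid \<Rightarrow> ('e \<Rightarrow> 'f) set" where
  "circuits M = {X. \<exists>\<phi>\<in>gp_class M. \<exists>a. a \<noteq> 0 \<and>
     (\<exists>ys\<in>tuples (ground M) (Suc (frank M)). distinct ys \<and>
        (\<exists>k\<le>frank M. \<phi> (omit k ys) \<noteq> 0) \<and>
        (\<forall>i\<le>frank M. X (ys ! i) = a * (neg_one ^ i * \<phi> (omit i ys))) \<and>
        (\<forall>e. e \<notin> set ys \<longrightarrow> X e = 0))}"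

definition cocircuits :: "('e, 'f::idyll) fmatroid \<Rightarrow> ('e \<Rightarrow> 'f) set" where
  "cocircuits M = circuits (dual M)"

definition orthogonal :: "'e set \<Rightarrow> ('e \<Rightarrow> 'f::idyll) \<Rightarrow> ('e \<Rightarrow> 'f) \<Rightarrow> bool" where
  "orthogonal E X Y \<longleftrightarrow> formal_sum (\<lambda>e. X e * Y e) E \<in> nullset"

definition vectors :: "('e, 'f::idyll) fmatroid \<Rightarrow> ('e \<Rightarrow> 'f) set" where
  "vectors M = {X \<in> tuple_space (ground M). \<forall>Y\<in>cocircuits M. orthogonal (ground M) X Y}"

definition covectors :: "('e, 'f::idyll) fmatroid \<Rightarrow> ('e \<Rightarrow> 'f) set" where
  "covectors M = {X \<in> tuple_space (ground M). \<forall>Y\<in>circuits M. orthogonal (ground M) X Y}"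

text \<open>
  Perfection quantifies over matroids on all finite sets.  Every finite set is in bijection
  with a finite set of natural numbers, and relabelling the ground set along a bijection
  preserves all the notions above, so ground sets inside \<open>nat\<close> suffice.
\<close>

definition perfect_idyll :: "'f::idyll itself \<Rightarrow> bool" where
  "perfect_idyll _ \<longleftrightarrow>
     (\<forall>M :: (nat, 'f) fmatroid. is_fmatroid M \<longrightarrow>
        (\<forall>X\<in>vectors M. \<forall>Y\<in>covectors M. orthogonal (ground M) X Y))"


section \<open>Submonomial matrices and morphisms\<close>

text \<open>
  A matrix indexed by \<open>T \<times> S\<close> is a function of two arguments; its values outside
  \<open>T \<times> S\<close> play no role.
\<close>

definition submonomial :: "'t set \<Rightarrow> 's set \<Rightarrow> ('t \<Rightarrow> 's \<Rightarrow> 'f::zero) \<Rightarrow> bool" where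
  "submonomial T S \<Phi> \<longleftrightarrow>
     (\<forall>i\<in>T. \<forall>j\<in>S. \<forall>j'\<in>S. \<Phi> i j \<noteq> 0 \<and> \<Phi> i j' \<noteq> 0 \<longrightarrow> j = j') \<and>
     (\<forall>j\<in>S. \<forall>i\<in>T. \<forall>i'\<in>T. \<Phi> i j \<noteq> 0 \<and> \<Phi> i' j \<noteq> 0 \<longrightarrow> i = i')"

text \<open>
  The sum over \<open>j\<close> is formed in \<open>\<nat>[F\<^sup>\<times>]\<close>; for a submonomial matrix it has at most one
  nonzero term and hence is an element of \<open>F\<close>.
\<close>

definition mat_apply ::
  "'t set \<Rightarrow> 's set \<Rightarrow> ('t \<Rightarrow> 's \<Rightarrow> 'f::idyll) \<Rightarrow> ('s \<Rightarrow> 'f) \<Rightarrow> 't \<Rightarrow> 'f" where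
  "mat_apply T S \<Phi> X i =
     (if i \<in> T then THE a. formal_elem a = formal_sum (\<lambda>j. \<Phi> i j * X j) S else 0)"

definition fmorphism ::
  "('t \<Rightarrow> 's \<Rightarrow> 'f::idyll) \<Rightarrow> ('s, 'f) fmatroid \<Rightarrow> ('t, 'f) fmatroid \<Rightarrow> bool" where
  "fmorphism \<Phi> N M \<longleftrightarrow>
     submonomial (ground M) (ground N) \<Phi> \<and>
     mat_apply (ground M) (ground N) \<Phi> ` vectors N \<subseteq> vectors M"

text \<open>The pointed set \<open>S \<squnion> {0}\<close> lives in the option type, with \<open>None\<close> as base point.\<close>

definition pointed :: "'e set \<Rightarrow> 'e option set" where
  "pointed S = insert None (Some ` S)"

definition underlying_map ::
  "'t set \<Rightarrow> 's set \<Rightarrow> ('t \<Rightarrow> 's \<Rightarrow> 'f::zero) \<Rightarrow> 's option \<Rightarrow> 't option" where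
  "underlying_map T S \<Phi> x =
     (case x of
        None \<Rightarrow> None
      | Some j \<Rightarrow> if j \<in> S \<and> (\<exists>i\<in>T. \<Phi> i j \<noteq> 0)
                  then Some (THE i. i \<in> T \<and> \<Phi> i j \<noteq> 0) else None)"


section \<open>Ordinary matroids and strong maps\<close>

record 'e matroid =
  elements :: "'e set"
  bases :: "'e set set"

definition is_matroid :: "'e matroid \<Rightarrow> bool" where
  "is_matroid M \<longleftrightarrow> finite (elements M) \<and> bases M \<noteq> {} \<and> bases M \<subseteq> Pow (elements M) \<and>
     (\<forall>B\<in>bases M. \<forall>B'\<in>bases M. \<forall>x\<in>B - B'. \<exists>y\<in>B' - B. insert y (B - {x}) \<in> bases M)"

definition indep :: "'e matroid \<Rightarrow> 'e set \<Rightarrow> bool" where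
  "indep M I \<longleftrightarrow> (\<exists>B\<in>bases M. I \<subseteq> B)"

definition mrank :: "'e matroid \<Rightarrow> 'e set \<Rightarrow> nat" where
  "mrank M A = Max (card ` {I. I \<subseteq> A \<and> indep M I})"

definition flat :: "'e matroid \<Rightarrow> 'e set \<Rightarrow> bool" where
  "flat M A \<longleftrightarrow> A \<subseteq> elements M \<and> (\<forall>e\<in>elements M - A. mrank M A < mrank M (insert e A))"

text \<open>The base point, lying in no basis, is a loop.\<close>

definition add_loop :: "'e matroid \<Rightarrow> 'e option matroid" where
  "add_loop M = \<lparr>elements = pointed (elements M), bases = image Some ` bases M\<rparr>"

definition strong_map ::
  "('s option \<Rightarrow> 't option) \<Rightarrow> 's matroid \<Rightarrow> 't matroid \<Rightarrow> bool" where
  "strong_map \<sigma> N M \<longleftrightarrow>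
     \<sigma> ` pointed (elements N) \<subseteq> pointed (elements M) \<and> \<sigma> None = None \<and>
     (\<forall>A. flat (add_loop M) A \<longrightarrow> flat (add_loop N) {x \<in> pointed (elements N). \<sigma> x \<in> A})"

definition underlying_matroid :: "('e, 'f::idyll) fmatroid \<Rightarrow> 'e matroid" where
  "underlying_matroid M =
     \<lparr>elements = ground M, bases = {set xs | xs. \<exists>\<phi>\<in>gp_class M. \<phi> xs \<noteq> 0}\<rparr>"


lemma underlying_is_matroid:
  assumes "is_fmatroid M"
  shows "is_matroid (underlying_matroid M)"
proof -
  obtain \<phi> where gp: "grassmann_pluecker (ground M) (frank M) \<phi>"
    and cls: "gp_class M = {\<lambda>xs. a * \<phi> xs | a. a \<noteq> 0}" and fin: "finite (ground M)"
    using assms by (auto simp: is_fmatroid_def)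
  let ?E = "ground M" and ?r = "frank M"
  have nz: "a * b \<noteq> 0" if "a \<noteq> 0" "b \<noteq> 0" for a b :: 'b
  proof
    assume 0: "a * b = 0"
    obtain c where c: "a * c = 1" using unit_inverse \<open>a \<noteq> 0\<close> by blast
    have "b = (a * c) * b" by (simp add: c)
    also have "\<dots> = c * (a * b)" by (simp only: mult.assoc mult.left_commute)
    finally show False using 0 \<open>b \<noteq> 0\<close> by simp
  qed
  have supp: "xs \<in> tuples ?E ?r \<and> distinct xs" if "\<phi> xs \<noteq> 0" for xs
    using gp that unfolding grassmann_pluecker_def by blast
  have bases: "bases (underlying_matroid M) = {set xs | xs. \<phi> xs \<noteq> 0}"
  proof -
    have "(\<exists>\<psi>\<in>gp_class M. \<psi> xs \<noteq> 0) \<longleftrightarrow> \<phi> xs \<noteq> 0" for xs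
    proof
      assume "\<exists>\<psi>\<in>gp_class M. \<psi> xs \<noteq> 0"
      then show "\<phi> xs \<noteq> 0" unfolding cls by auto
    next
      assume "\<phi> xs \<noteq> 0"
      moreover have "(\<lambda>xs. 1 * \<phi> xs) \<in> gp_class M"
        unfolding cls by (rule CollectI, rule exI[of _ 1]) simp
      ultimately show "\<exists>\<psi>\<in>gp_class M. \<psi> xs \<noteq> 0" by force
    qed
    then show ?thesis by (simp add: underlying_matroid_def)
  qed
  have neg: "(neg_one::'b) \<noteq> 0"
    unfolding neg_one_def using theI'[OF nullset_neg_one[where 'a='b]] by blast
  have negp: "(neg_one::'b) ^ k \<noteq> 0" for k
    by (induction k) (auto simp: neg nz)
  have alt: "\<phi> (permute_list \<sigma> xs) = of_sign (sign \<sigma>) * \<phi> xs"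
    if "xs \<in> tuples ?E ?r" "\<sigma> permutes {..<?r}" for xs \<sigma>
    using gp that unfolding grassmann_pluecker_def by blast
  have reorder: "\<phi> ys \<noteq> 0" if nz_xs: "\<phi> xs \<noteq> 0" and eq: "mset ys = mset xs" for xs ys
  proof -
    obtain p where p: "p permutes {..<length xs}" "permute_list p xs = ys"
      using mset_eq_permutation[OF eq] by blast
    have "length xs = ?r" "xs \<in> tuples ?E ?r" using supp[OF nz_xs] by (auto simp: tuples_def)
    with p have "\<phi> ys = of_sign (sign p) * \<phi> xs"
      using alt[of xs p] by simp
    then show ?thesis using nz_xs neg nz by (auto simp: of_sign_def)
  qed
  have exch: "\<exists>y\<in>B' - B. insert y (B - {x}) \<in> bases (underlying_matroid M)"
    if B: "B \<in> bases (underlying_matroid M)" and B': "B' \<in> bases (underlying_matroid M)"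
      and x: "x \<in> B - B'" for B B' x
  proof -
    obtain us vs where us: "B = set us" "\<phi> us \<noteq> 0" and vs: "B' = set vs" "\<phi> vs \<noteq> 0"
      using B B' bases by auto
    let ?xs = "remove1 x us" and ?ys = "x # vs"
    have u: "us \<in> tuples ?E ?r" "distinct us" and v: "vs \<in> tuples ?E ?r" "distinct vs"
      using supp us vs by auto
    have xu: "x \<in> set us" and xv: "x \<notin> set vs" using x us vs by auto
    have set_xs: "set ?xs = B - {x}" using u us by simp
    have len: "Suc (length ?xs) = ?r" 
      using xu u length_pos_if_in_set[OF xu] by (simp add: length_remove1 tuples_def)
    have sub: "set ?xs \<subseteq> ?E" using u set_xs us by (auto simp: tuples_def)
    have yt: "?ys \<in> tuples ?E (Suc ?r)" using u v xu by (auto simp: tuples_def)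
    let ?t = "\<lambda>k. neg_one ^ k * \<phi> (omit k ?ys) * \<phi> (?ys ! k # ?xs)"
    have gpr: "formal_sum ?t {0..?r} \<in> nullset"
      using gp len sub yt unfolding grassmann_pluecker_def by blast
    have x0: "\<phi> (x # ?xs) \<noteq> 0"
      by (rule reorder[OF us(2)]) (use xu in simp)
    have t0: "?t 0 \<noteq> 0" using x0 vs nz by (simp add: omit_def)
    have "\<exists>k\<in>{1..?r}. ?t k \<noteq> 0"
    proof (rule ccontr)
      assume "\<not> ?thesis"
      then have z: "\<forall>k\<in>{1..?r}. ?t k = 0" by blast
      have "formal_sum ?t {0..?r} = formal_elem (?t 0) + (\<Sum>k\<in>{1..?r}. formal_elem (?t k))"
        unfolding formal_sum_def by (subst sum.atLeast_Suc_atMost) simp_all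
      also have "(\<Sum>k\<in>{1..?r}. formal_elem (?t k)) = {#}"
      proof (rule sum.neutral, rule ballI)
        fix k assume "k \<in> {1..?r}"
        then have "?t k = 0" using z by blast
        then show "formal_elem (?t k) = {#}" by (simp only: formal_elem_def if_True simp_thms)
      qed
      finally have "formal_elem (?t 0) \<in> nullset" using gpr by simp
      then obtain c :: 'b where c: "c \<noteq> 0" "{#c#} \<in> nullset"
        using t0 unfolding formal_elem_def by metis
      obtain b where b: "c * b = 1" using unit_inverse c(1) by blast
      then have "b \<noteq> 0" by force
      then have "formal_times {#b#} {#c#} \<in> nullset"
        by (intro nullset_times c) simp
      then have "{#1::'b#} \<in> nullset" using b by (simp add: formal_times_def mult.commute)
      then show False using nullset_one by blast
    qed
    then obtain k where k: "k \<in> {1..?r}" "?t k \<noteq> 0" by blast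
    then have nzk: "\<phi> (?ys ! k # ?xs) \<noteq> 0" by (metis mult_zero_right)
    let ?y = "?ys ! k"
    have yv: "?y \<in> set vs" using k v by (auto simp: tuples_def nth_Cons')
    then have "?y \<noteq> x" using xv by metis
    moreover have "?y \<notin> B - {x}" using supp[OF nzk] by (simp only: set_xs distinct.simps simp_thms)
    ultimately have "?y \<in> B' - B" using yv vs(1) by simp
    moreover have "insert ?y (B - {x}) \<in> bases (underlying_matroid M)"
    proof -
      have "insert ?y (B - {x}) = set (?y # ?xs)" by (simp only: list.set set_xs)
      then show ?thesis unfolding bases using nzk by blast
    qed
    ultimately show ?thesis by blast
  qed
  have "bases (underlying_matroid M) \<noteq> {}"
    using gp unfolding bases grassmann_pluecker_def by auto
  moreover have "bases (underlying_matroid M) \<subseteq> Pow ?E"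
    using supp unfolding bases by (auto simp: tuples_def)
  moreover have "elements (underlying_matroid M) = ?E" by (simp add: underlying_matroid_def)
  ultimately show ?thesis
    unfolding is_matroid_def using fin exch by auto
qed

end

theory Submission
  imports Defs
begin

text \<open>
  Two facts about an ordinary matroid drive the proof.  Flats are governed by cocircuits: the
  complement of a fundamental cocircuit is a flat (\<open>flat_Compl_fund_cocircuit\<close>), and every element
  outside a flat lies on a fundamental cocircuit that avoids the flat
  (\<open>flat_avoided_by_fund_cocircuit\<close>).  Failure to be flat is detected by circuits: a set \<open>A\<close> that is
  not flat admits a fundamental circuit that leaves \<open>A\<close> in exactly one element
  (\<open>not_flat_fund_circuit\<close>).

  Orthogonality interacts with this through supports.  The nullset of an idyll contains no formal
  sum with a single term, so orthogonal vectors never have exactly one position in common; over the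
  Krasner hyperfield this is all that orthogonality says.  Since each row and each column of a
  submonomial matrix \<open>\<Phi>\<close> has at most one nonzero entry, the common positions of \<open>\<Phi> \<cdot> X\<close> and \<open>Y\<close>
  correspond bijectively to those \<open>j\<close> in the support of \<open>X\<close> that \<open>\<Phi>\<close> maps into the support of \<open>Y\<close>.

  If \<open>\<Phi>\<close> is a morphism and the preimage \<open>Q\<close> of a flat \<open>A\<close> were not flat, some circuit \<open>X\<close> of \<open>N\<close>
  would leave \<open>Q\<close> in a single element \<open>e\<close>.  The image \<open>i\<close> of \<open>e\<close> lies outside \<open>A\<close>, hence on a
  cocircuit \<open>Y\<close> of \<open>M\<close> that avoids \<open>A\<close>, and then \<open>\<Phi> \<cdot> X\<close> and \<open>Y\<close> meet in \<open>i\<close> only.  This is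
  impossible because the circuit \<open>X\<close> is a vector of \<open>N\<close>, so \<open>\<Phi> \<cdot> X\<close> is orthogonal to \<open>Y\<close>
  (\<open>fmorphism_imp_strong_map\<close>).

  Conversely, over the Krasner hyperfield, let \<open>\<Phi> \<cdot> X\<close> meet a cocircuit \<open>Y\<close> of \<open>M\<close> in a single
  position, the image of \<open>j\<close>.  The complement of the support of \<open>Y\<close> is a flat, so its preimage is a
  flat of \<open>N\<close> when the underlying map is strong.  A cocircuit of \<open>N\<close> through \<open>j\<close> that avoids this
  preimage meets \<open>X\<close> in \<open>j\<close> only, so \<open>X\<close> is not a vector
  (\<open>krasner_strong_map_imp_fmorphism\<close>).

  The remaining input is that circuits with coefficients are vectors
  (\<open>circuits_subset_vectors\<close>).  A cocircuit turns out to be a multiple of \<open>x \<mapsto> \<phi>(x, w)\<close> for a fixed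
  tuple \<open>w\<close> (\<open>cocircuits_iff\<close>), and its pairing with a circuit is then a multiple of a
  Grassmann-Pluecker relation.  The work lies in checking that the signs in the definition
  of the dual cancel.
\<close>

section \<open>Flats, fundamental circuits and fundamental cocircuits\<close>

lemma bases_exchange:
  assumes "is_matroid M" "B \<in> bases M" "B' \<in> bases M" "x \<in> B - B'"
  obtains y where "y \<in> B' - B" "insert y (B - {x}) \<in> bases M"
  using assms unfolding is_matroid_def by blast

lemma finite_elements: "is_matroid M \<Longrightarrow> finite (elements M)"
  by (simp add: is_matroid_def)

lemma basis_subset: "is_matroid M \<Longrightarrow> B \<in> bases M \<Longrightarrow> B \<subseteq> elements M"
  by (auto simp: is_matroid_def)

lemma finite_basis: "is_matroid M \<Longrightarrow> B \<in> bases M \<Longrightarrow> finite B"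
  using basis_subset finite_elements finite_subset by metis

lemma basis_antichain:
  assumes "is_matroid M" "B \<in> bases M" "B' \<in> bases M" "B \<subseteq> B'"
  shows "B = B'"
  using bases_exchange[OF assms(1,3,2)] assms(4) by blast

text \<open>
  Exchanging an element of \<open>B - B'\<close> for one of \<open>B' - B\<close> preserves the size of \<open>B\<close> and shrinks
  the difference \<open>B - B'\<close>.
\<close>

lemma bases_card_eq:
  assumes M: "is_matroid M" and "B \<in> bases M" and B': "B' \<in> bases M"
  shows "card B = card B'"
  using assms(2)
proof (induction "card (B - B')" arbitrary: B rule: less_induct)
  case less
  note fin = finite_basis[OF M less.prems]
  show ?case
  proof (cases "B \<subseteq> B'")
    case True
    then show ?thesis using basis_antichain[OF M less.prems B'] by simp
  next
    case False
    then obtain x where x: "x \<in> B - B'" by blast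
    obtain y where y: "y \<in> B' - B" "insert y (B - {x}) \<in> bases M"
      using bases_exchange[OF M less.prems B' x] .
    have "insert y (B - {x}) - B' = (B - B') - {x}" using x y by blast
    moreover have "card ((B - B') - {x}) < card (B - B')"
      using x fin by (intro card_Diff1_less) auto
    ultimately have "card (insert y (B - {x})) = card B'"
      using less.hyps y(2) by metis
    moreover have "card (insert y (B - {x})) = card B"
      using card.remove[OF fin, of x] x y fin by simp
    ultimately show ?thesis by simp
  qed
qed

lemma finite_indep_cards:
  assumes "is_matroid M"
  shows "finite (card ` {I. I \<subseteq> A \<and> indep M I})"
proof -
  have "{I. I \<subseteq> A \<and> indep M I} \<subseteq> Pow (elements M)"
    using basis_subset[OF assms] unfolding indep_def by blast
  then show ?thesis
    using finite_elements[OF assms] by (meson finite_Pow_iff finite_imageI finite_subset)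
qed

lemma card_le_mrank:
  assumes "is_matroid M" "I \<subseteq> A" "indep M I"
  shows "card I \<le> mrank M A"
  unfolding mrank_def using finite_indep_cards[OF assms(1)] assms(2,3) by (intro Max_ge) auto

lemma obtain_mrank:
  assumes "is_matroid M"
  obtains I where "I \<subseteq> A" "indep M I" "card I = mrank M A"
proof -
  have "{} \<in> {I. I \<subseteq> A \<and> indep M I}"
    using assms unfolding is_matroid_def indep_def by auto
  then have "mrank M A \<in> card ` {I. I \<subseteq> A \<and> indep M I}"
    unfolding mrank_def using finite_indep_cards[OF assms] by (intro Max_in) auto
  then show ?thesis using that by auto
qed

lemma finite_indep: "is_matroid M \<Longrightarrow> indep M I \<Longrightarrow> finite I"
  unfolding indep_def using finite_basis finite_subset by metis

definition fund_circuit :: "'e matroid \<Rightarrow> 'e set \<Rightarrow> 'e \<Rightarrow> 'e set" where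
  "fund_circuit M B e = {x \<in> insert e B. insert e B - {x} \<in> bases M}"

text \<open>
  For \<open>e \<in> B\<close> this is the complement of the hyperplane that \<open>B - {e}\<close> spans.
\<close>

definition fund_cocircuit :: "'e matroid \<Rightarrow> 'e set \<Rightarrow> 'e \<Rightarrow> 'e set" where
  "fund_cocircuit M B e = {x. insert x (B - {e}) \<in> bases M}"

lemma fund_cocircuit_disjoint:
  assumes M: "is_matroid M" and B: "B \<in> bases M" "e \<in> B"
  shows "fund_cocircuit M B e \<inter> (B - {e}) = {}"
proof (rule ccontr)
  assume "\<not> ?thesis"
  then obtain x where "x \<in> B - {e}" "insert x (B - {e}) \<in> bases M"
    unfolding fund_cocircuit_def by blast
  then have "B - {e} \<in> bases M" by (simp add: insert_absorb)
  then have "B - {e} = B" using basis_antichain[OF M _ B(1)] by blast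
  then show False using B(2) by blast
qed

text \<open>
  Adjoining \<open>e\<close> raises the rank of the flat, so a largest independent subset \<open>J\<close> of \<open>insert e A\<close>
  contains \<open>e\<close>.  Extend \<open>J\<close> to a basis.  An element of \<open>A\<close> on the resulting cocircuit could replace
  \<open>e\<close> in \<open>J\<close>, giving an independent subset of \<open>A\<close> that is too large.
\<close>

lemma flat_avoided_by_fund_cocircuit:
  assumes M: "is_matroid M" and A: "flat M A" and e: "e \<in> elements M - A"
  obtains B where "B \<in> bases M" "e \<in> B" "fund_cocircuit M B e \<inter> A = {}"
proof -
  have less: "mrank M A < mrank M (insert e A)" using A e unfolding flat_def by blast
  obtain J where J: "J \<subseteq> insert e A" "indep M J" "card J = mrank M (insert e A)"
    using obtain_mrank[OF M] .
  have eJ: "e \<in> J"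
  proof (rule ccontr)
    assume "e \<notin> J"
    then have "card J \<le> mrank M A" using J by (intro card_le_mrank[OF M]) auto
    then show False using J(3) less by simp
  qed
  obtain B where B: "B \<in> bases M" "J \<subseteq> B" using J(2) unfolding indep_def by blast
  have eB: "e \<in> B" using eJ B(2) by blast
  have "fund_cocircuit M B e \<inter> A = {}"
  proof (rule ccontr)
    assume "\<not> ?thesis"
    then obtain x where x: "x \<in> fund_cocircuit M B e" "x \<in> A" by blast
    have "x \<notin> B - {e}" using fund_cocircuit_disjoint[OF M B(1) eB] x(1) by blast
    then have "x \<notin> J - {e}" using B(2) by blast
    then have card: "card (insert x (J - {e})) = card J"
      using card.remove[OF finite_indep[OF M J(2)] eJ] finite_indep[OF M J(2)] by simp
    have "insert x (B - {e}) \<in> bases M" "insert x (J - {e}) \<subseteq> insert x (B - {e})"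
      using x(1) B(2) by (auto simp: fund_cocircuit_def)
    then have "indep M (insert x (J - {e}))" unfolding indep_def by blast
    then have "card (insert x (J - {e})) \<le> mrank M A"
      using J(1) x(2) by (intro card_le_mrank[OF M]) auto
    then show False using card J(3) less by linarith
  qed
  then show thesis using that B(1) eB by blast
qed

text \<open>
  Each \<open>x\<close> on the cocircuit completes \<open>B - {e}\<close>, which avoids the cocircuit, to a basis, so the
  complement together with \<open>x\<close> has full rank.  The complement itself contains no basis: exchanging \<open>x\<close>
  into such a basis would produce an element of the cocircuit in it.
\<close>

lemma flat_Compl_fund_cocircuit:
  assumes M: "is_matroid M" and B: "B \<in> bases M" "e \<in> B"
  shows "flat M (elements M - fund_cocircuit M B e)" (is "flat M ?A")
proof -
  let ?D = "fund_cocircuit M B e"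
  have "mrank M ?A < mrank M (insert x ?A)" if x: "x \<in> ?D" for x
  proof -
    let ?B = "insert x (B - {e})"
    have Bx: "?B \<in> bases M" using x unfolding fund_cocircuit_def by blast
    have "B - {e} \<subseteq> ?A"
      using fund_cocircuit_disjoint[OF M B] basis_subset[OF M B(1)] by blast
    then have big: "card ?B \<le> mrank M (insert x ?A)"
      using Bx by (intro card_le_mrank[OF M]) (auto simp: indep_def)
    obtain J where J: "J \<subseteq> ?A" "indep M J" "card J = mrank M ?A"
      using obtain_mrank[OF M] .
    obtain B' where B': "B' \<in> bases M" "J \<subseteq> B'" using J(2) unfolding indep_def by blast
    have "card J < card ?B"
    proof (rule ccontr)
      assume "\<not> ?thesis"
      then have "card B' \<le> card J" using bases_card_eq[OF M B'(1) Bx] by simp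
      then have "B' = J" using B'(2) finite_basis[OF M B'(1)] by (metis card_seteq)
      then have sub: "B' \<subseteq> ?A" using J(1) by simp
      then have "x \<in> ?B - B'" using x by blast
      then obtain y where y: "y \<in> B' - ?B" "insert y (?B - {x}) \<in> bases M"
        using bases_exchange[OF M Bx B'(1)] by blast
      have "x \<notin> B - {e}" using fund_cocircuit_disjoint[OF M B] x by blast
      then have "?B - {x} = B - {e}" by blast
      then have "y \<in> ?D" using y(2) unfolding fund_cocircuit_def by simp
      then show False using sub y(1) by blast
    qed
    then show ?thesis using big J(3) by simp
  qed
  then show ?thesis unfolding flat_def by blast
qed

text \<open>
  If adjoining \<open>e\<close> does not raise the rank, then \<open>e\<close> depends on a largest independent subset \<open>I\<close>
  of \<open>A\<close>.  For a basis \<open>B\<close> extending \<open>I\<close>, removing an element outside \<open>insert e I\<close> from \<open>insert e B\<close>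
  leaves a dependent set, so the fundamental circuit of \<open>e\<close> stays inside \<open>insert e I\<close>.
\<close>

lemma not_flat_fund_circuit:
  assumes M: "is_matroid M" and A: "A \<subseteq> elements M" "\<not> flat M A"
  obtains B e where "B \<in> bases M" "e \<in> elements M - A" "e \<notin> B" "fund_circuit M B e \<subseteq> insert e A"
proof -
  obtain e where e: "e \<in> elements M - A" "\<not> mrank M A < mrank M (insert e A)"
    using A unfolding flat_def by blast
  obtain I where I: "I \<subseteq> A" "indep M I" "card I = mrank M A"
    using obtain_mrank[OF M] .
  have dep: "\<not> indep M (insert e I)"
  proof
    assume "indep M (insert e I)"
    then have "card (insert e I) \<le> mrank M (insert e A)"
      using I(1) by (intro card_le_mrank[OF M]) auto
    moreover have "card (insert e I) = Suc (card I)"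
      using e(1) I(1) finite_indep[OF M I(2)] by (intro card_insert_disjoint) auto
    ultimately show False using I(3) e(2) by simp
  qed
  obtain B where B: "B \<in> bases M" "I \<subseteq> B" using I(2) unfolding indep_def by blast
  have "e \<notin> B"
  proof
    assume "e \<in> B"
    then have "insert e I \<subseteq> B" using B(2) by blast
    then show False using dep B(1) unfolding indep_def by blast
  qed
  moreover have "fund_circuit M B e \<subseteq> insert e A"
  proof
    fix x assume x: "x \<in> fund_circuit M B e"
    show "x \<in> insert e A"
    proof (rule ccontr)
      assume "x \<notin> insert e A"
      then have "insert e I \<subseteq> insert e B - {x}" using I(1) B(2) by blast
      then show False using dep x unfolding indep_def fund_circuit_def by blast
    qed
  qed
  ultimately show thesis using that B(1) e(1) by blast
qed

section \<open>Adjoining a loop\<close>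

lemma indep_add_loop: "indep (add_loop M) I \<longleftrightarrow> (\<exists>J. I = Some ` J \<and> indep M J)"
  unfolding indep_def add_loop_def by (auto simp: subset_image_iff)

lemma mrank_add_loop: "mrank (add_loop M) A = mrank M {x. Some x \<in> A}"
proof -
  have "{I. I \<subseteq> A \<and> indep (add_loop M) I} =
      image Some ` {J. J \<subseteq> {x. Some x \<in> A} \<and> indep M J}"
    unfolding indep_add_loop by auto
  then show ?thesis
    unfolding mrank_def by (simp add: image_image card_image)
qed

text \<open>
  The base point never raises a rank, so every flat contains it; on the other elements the ranks
  are unchanged.  This removes base points from the study of strong maps.
\<close>

lemma flat_add_loop:
  "flat (add_loop M) A \<longleftrightarrow> None \<in> A \<and> A \<subseteq> pointed (elements M) \<and> flat M {x. Some x \<in> A}"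
proof -
  have ins: "{x. Some x \<in> insert (Some e) A} = insert e {x. Some x \<in> A}" for e by auto
  have elems: "elements (add_loop M) = insert None (Some ` elements M)"
    by (simp add: add_loop_def pointed_def)
  have none: "{x. Some x \<in> insert None A} = {x. Some x \<in> A}" by auto
  have split: "(\<forall>e\<in>insert None (Some ` S) - A. P e) \<longleftrightarrow>
      (None \<in> A \<or> P None) \<and> (\<forall>e\<in>S - {x. Some x \<in> A}. P (Some e))" for S :: "'a set" and P
    by auto
  have "(\<forall>e\<in>elements (add_loop M) - A.
      mrank M {x. Some x \<in> A} < mrank M {x. Some x \<in> insert e A}) \<longleftrightarrow>
    None \<in> A \<and> (\<forall>e\<in>elements M - {x. Some x \<in> A}.
      mrank M {x. Some x \<in> A} < mrank M (insert e {x. Some x \<in> A}))"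
    unfolding elems split ins none by simp
  moreover have "A \<subseteq> pointed (elements M) \<Longrightarrow> {x. Some x \<in> A} \<subseteq> elements M"
    by (auto simp: pointed_def)
  ultimately show ?thesis
    unfolding flat_def mrank_add_loop elems by (auto simp: pointed_def)
qed

section \<open>Formal sums in idylls\<close>

lemma formal_elem_inject: "formal_elem a = formal_elem b \<longleftrightarrow> a = b"
  by (auto simp: formal_elem_def)

lemma formal_elem_zero [simp]: "formal_elem 0 = {#}"
  by (simp add: formal_elem_def)

lemma formal_sum_mono_neutral:
  assumes "finite I" "J \<subseteq> I" "\<And>i. i \<in> I - J \<Longrightarrow> f i = 0"
  shows "formal_sum f I = formal_sum f J"
  unfolding formal_sum_def using assms by (intro sum.mono_neutral_right) auto

lemma size_formal_sum:
  assumes "finite I"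
  shows "size (formal_sum f I) = card {i \<in> I. f i \<noteq> 0}"
proof -
  have "size (formal_sum f I) = (\<Sum>i\<in>I. if f i \<noteq> 0 then 1 else 0)"
    unfolding formal_sum_def
    using assms by (induction I rule: finite_induct) (auto simp: formal_elem_def)
  then show ?thesis using assms by (simp add: sum.If_cases Int_def)
qed

lemma zero_notin_formal_sum: "finite I \<Longrightarrow> 0 \<notin># formal_sum f I"
  unfolding formal_sum_def
  by (induction I rule: finite_induct) (auto simp: formal_elem_def)

lemma idyll_mult_nonzero:
  fixes a b :: "'f::idyll"
  shows "a * b \<noteq> 0 \<longleftrightarrow> a \<noteq> 0 \<and> b \<noteq> 0"
proof -
  have "b = 0" if 0: "a * b = 0" and "a \<noteq> 0"
  proof -
    obtain c where c: "a * c = 1" using unit_inverse \<open>a \<noteq> 0\<close> by blast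
    have "b = (a * c) * b" by (simp add: c)
    also have "\<dots> = c * (a * b)" by (simp only: mult.assoc mult.left_commute)
    finally show ?thesis using 0 by simp
  qed
  then show ?thesis by auto
qed

lemma idyll_mult_zero_iff: "a * b = 0 \<longleftrightarrow> a = 0 \<or> b = (0::'f::idyll)"
  using idyll_mult_nonzero[of a b] by blast

lemma formal_sum_scale:
  fixes f :: "'i \<Rightarrow> 'f::idyll"
  assumes "c \<noteq> 0"
  shows "formal_sum (\<lambda>i. c * f i) I = formal_times {#c#} (formal_sum f I)"
proof -
  have "formal_elem (c * a) = image_mset ((*) c) (formal_elem a)" for a :: 'f
    using assms by (auto simp: formal_elem_def idyll_mult_zero_iff)
  then show ?thesis
    unfolding formal_sum_def formal_times_def
    by (induction I rule: infinite_finite_induct) auto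
qed

text \<open>
  Scaling by the inverse of the only term would put the formal sum 1 into the nullset.
\<close>

lemma singleton_notin_nullset: "{#a#} \<notin> (nullset :: 'f::idyll multiset set)"
proof
  assume a: "{#a#} \<in> nullset"
  then have "a \<noteq> 0" using nullset_nonzero by force
  then obtain b where b: "a * b = 1" using unit_inverse by blast
  then have "b \<noteq> 0" by force
  then have "formal_times {#b#} {#a#} \<in> nullset" using a by (intro nullset_times) auto
  then have "{#1 :: 'f#} \<in> nullset" using b by (simp add: formal_times_def mult.commute)
  then show False using nullset_one by blast
qed

section \<open>Submonomial matrices and their underlying maps\<close>

lemma mat_apply_nonzero:
  fixes \<Phi> :: "'t \<Rightarrow> 's \<Rightarrow> 'f::idyll"
  assumes \<Phi>: "submonomial T S \<Phi>" and S: "finite S"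
  shows "mat_apply T S \<Phi> X i \<noteq> 0 \<longleftrightarrow> i \<in> T \<and> (\<exists>j\<in>S. \<Phi> i j \<noteq> 0 \<and> X j \<noteq> 0)"
proof (cases "i \<in> T \<and> (\<exists>j\<in>S. \<Phi> i j \<noteq> 0)")
  case True
  then obtain j where i: "i \<in> T" and j: "j \<in> S" "\<Phi> i j \<noteq> 0" by blast
  have uniq: "j' = j" if "j' \<in> S" "\<Phi> i j' \<noteq> 0" for j'
    using \<Phi> i j that unfolding submonomial_def by blast
  \<comment> \<open>The row \<open>i\<close> has its only nonzero entry in column \<open>j\<close>, so the sum collapses to one term.\<close>
  have "\<Phi> i j' * X j' = 0" if "j' \<in> S - {j}" for j'
  proof -
    have "\<Phi> i j' = 0" using uniq[of j'] that by blast
    then show ?thesis by simp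
  qed
  then have "formal_sum (\<lambda>j. \<Phi> i j * X j) S = formal_sum (\<lambda>j. \<Phi> i j * X j) {j}"
    using S j by (intro formal_sum_mono_neutral) auto
  then have "formal_sum (\<lambda>j. \<Phi> i j * X j) S = formal_elem (\<Phi> i j * X j)"
    by (simp add: formal_sum_def)
  then have "mat_apply T S \<Phi> X i = \<Phi> i j * X j"
    using i by (simp add: mat_apply_def formal_elem_inject)
  then have "mat_apply T S \<Phi> X i \<noteq> 0 \<longleftrightarrow> X j \<noteq> 0" using j by (simp add: idyll_mult_zero_iff)
  then show ?thesis using uniq i j by blast
next
  case False
  have "mat_apply T S \<Phi> X i = 0"
  proof (cases "i \<in> T")
    case True
    then have "\<forall>j\<in>S. \<Phi> i j = 0" using False by blast
    then have "formal_sum (\<lambda>j. \<Phi> i j * X j) S = formal_elem 0"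
      by (simp add: formal_sum_def)
    then show ?thesis using True by (simp only: mat_apply_def formal_elem_inject if_True the_eq_trivial)
  qed (simp add: mat_apply_def)
  then show ?thesis using False by blast
qed

lemma underlying_map_Some:
  assumes \<Phi>: "submonomial T S \<Phi>" and j: "j \<in> S"
  shows "underlying_map T S \<Phi> (Some j) = Some i \<longleftrightarrow> i \<in> T \<and> \<Phi> i j \<noteq> 0"
proof (cases "\<exists>i\<in>T. \<Phi> i j \<noteq> 0")
  case True
  then obtain k where k: "k \<in> T" "\<Phi> k j \<noteq> 0" by blast
  have uniq: "k' = k" if "k' \<in> T" "\<Phi> k' j \<noteq> 0" for k'
    using \<Phi> j k that unfolding submonomial_def by blast
  then have "(THE i. i \<in> T \<and> \<Phi> i j \<noteq> 0) = k" using k by blast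
  then have "underlying_map T S \<Phi> (Some j) = Some k" using True j by (simp add: underlying_map_def)
  then show ?thesis using k uniq by (metis option.inject)
qed (auto simp: underlying_map_def)

text \<open>
  The condition holds vacuously for columns without a nonzero entry: they are sent to the base
  point, which lies in every flat.
\<close>

definition preimage :: "'t set \<Rightarrow> 's set \<Rightarrow> ('t \<Rightarrow> 's \<Rightarrow> 'f::zero) \<Rightarrow> 't set \<Rightarrow> 's set" where
  "preimage T S \<Phi> A = {j \<in> S. \<forall>i\<in>T. \<Phi> i j \<noteq> 0 \<longrightarrow> i \<in> A}"

lemma strong_map_underlying_map:
  assumes \<Phi>: "submonomial (elements M) (elements N) \<Phi>"
  shows "strong_map (underlying_map (elements M) (elements N) \<Phi>) N M \<longleftrightarrow>
    (\<forall>A. flat M A \<longrightarrow> flat N (preimage (elements M) (elements N) \<Phi> A))"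
proof -
  let ?T = "elements M" and ?S = "elements N"
  let ?\<sigma> = "underlying_map ?T ?S \<Phi>"
  have None: "?\<sigma> None = None" by (simp add: underlying_map_def)
  have maps: "?\<sigma> ` pointed ?S \<subseteq> pointed ?T"
  proof -
    have "?\<sigma> (Some j) \<in> pointed ?T" if "j \<in> ?S" for j
      using underlying_map_Some[OF \<Phi> that] by (cases "?\<sigma> (Some j)") (auto simp: pointed_def)
    then show ?thesis using None by (auto simp: pointed_def)
  qed
  have pre: "flat (add_loop N) {x \<in> pointed ?S. ?\<sigma> x \<in> A} \<longleftrightarrow>
      flat N (preimage ?T ?S \<Phi> {x. Some x \<in> A})" if "None \<in> A" for A
  proof -
    have "?\<sigma> (Some j) \<in> A \<longleftrightarrow> (\<forall>i\<in>?T. \<Phi> i j \<noteq> 0 \<longrightarrow> Some i \<in> A)" if "j \<in> ?S" for j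
    proof (cases "?\<sigma> (Some j)")
      case None
      then show ?thesis using underlying_map_Some[OF \<Phi> that] \<open>None \<in> A\<close> by auto
    next
      case (Some k)
      then have "i \<in> ?T \<and> \<Phi> i j \<noteq> 0 \<longleftrightarrow> i = k" for i
        using underlying_map_Some[OF \<Phi> that, of i] by auto
      then show ?thesis using Some by metis
    qed
    then have "{j. Some j \<in> {x \<in> pointed ?S. ?\<sigma> x \<in> A}} = preimage ?T ?S \<Phi> {x. Some x \<in> A}"
      by (auto simp: preimage_def pointed_def)
    then show ?thesis
      using that None unfolding flat_add_loop by (auto simp: pointed_def)
  qed
  show ?thesis
  proof
    assume strong: "strong_map ?\<sigma> N M"
    show "\<forall>A. flat M A \<longrightarrow> flat N (preimage ?T ?S \<Phi> A)"
    proof (intro allI impI)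
      fix A assume A: "flat M A"
      have Some: "{x. Some x \<in> pointed A} = A" by (auto simp: pointed_def)
      have "A \<subseteq> elements M" using A by (simp add: flat_def)
      then have "flat (add_loop M) (pointed A)"
        unfolding flat_add_loop Some using A by (auto simp: pointed_def)
      then have "flat (add_loop N) {x \<in> pointed ?S. ?\<sigma> x \<in> pointed A}"
        using strong unfolding strong_map_def by blast
      moreover have "None \<in> pointed A" by (simp add: pointed_def)
      ultimately show "flat N (preimage ?T ?S \<Phi> A)" using pre[of "pointed A"] Some by simp
    qed
  next
    assume "\<forall>A. flat M A \<longrightarrow> flat N (preimage ?T ?S \<Phi> A)"
    then show "strong_map ?\<sigma> N M"
      unfolding strong_map_def using None maps pre flat_add_loop[of M] by blast
  qed
qed

section \<open>Signs\<close>

lemma neg_one_nullset: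
  shows neg_one_nonzero: "(neg_one :: 'f::idyll) \<noteq> 0"
    and "{#1, neg_one :: 'f#} \<in> nullset"
  unfolding neg_one_def using theI'[OF nullset_neg_one[where 'a='f]] by blast+

text \<open>
  Scaling \<open>1 + (-1)\<close> by the inverse of \<open>-1\<close> shows that this inverse is again an additive inverse
  of 1, and additive inverses of 1 are unique.
\<close>

lemma neg_one_square: "neg_one * neg_one = (1 :: 'f::idyll)"
proof -
  obtain c :: 'f where c: "neg_one * c = 1" using unit_inverse neg_one_nonzero by blast
  then have c0: "c \<noteq> 0" by force
  have "formal_times {#c#} {#1, neg_one#} \<in> nullset"
    using c0 by (intro nullset_times neg_one_nullset(2)) auto
  then have "{#1, c#} \<in> nullset"
    using c by (simp add: formal_times_def mult.commute add_mset_commute)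
  then have "c = neg_one"
    using nullset_neg_one[where 'a='f] c0 neg_one_nullset by blast
  then show ?thesis using c by simp
qed

lemma neg_one_power_nonzero: "(neg_one :: 'f::idyll) ^ k \<noteq> 0"
  by (induction k) (auto simp: neg_one_nonzero idyll_mult_zero_iff)

lemma of_sign_nonzero: "(of_sign s :: 'f::idyll) \<noteq> 0"
  by (auto simp: of_sign_def neg_one_nonzero)

lemma of_sign_uminus:
  "s = 1 \<or> s = -1 \<Longrightarrow> (of_sign (- s) :: 'f::idyll) = neg_one * of_sign s"
  by (auto simp: of_sign_def neg_one_square)

lemma permute_list_adjacent:
  "permute_list (transpose (length a) (Suc (length a))) (a @ x # y # b) = a @ y # x # b"
proof (rule nth_equalityI)
  fix i assume "i < length (permute_list (transpose (length a) (Suc (length a))) (a @ x # y # b))"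
  then have "i < length (a @ x # y # b)" by simp
  then show "permute_list (transpose (length a) (Suc (length a))) (a @ x # y # b) ! i =
      (a @ y # x # b) ! i"
    by (auto simp: permute_list_def transpose_def nth_append nth_Cons' simp del: upt_Suc)
qed simp

lemma transpose_permutes_adjacent:
  "transpose (length a) (Suc (length a)) permutes {..<length (a @ x # y # b)}"
  by (rule permutes_swap_id) auto

text \<open>
  Adjacent swaps generate all rearrangements of a list.  Hence invariance of a function under
  rearrangement, and the sign rules below, only need to be checked for adjacent swaps.
\<close>

lemma adjacent_swap_invariant:
  assumes "\<And>a x y b. mset (a @ x # y # b) = mset us \<Longrightarrow> f (a @ x # y # b) = f (a @ y # x # b)"
    and "mset vs = mset us"
  shows "f vs = f us"
  using assms
proof (induction us arbitrary: f vs)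
  case Nil
  then show ?case by simp
next
  case (Cons u us)
  have "u \<in> set vs" using Cons.prems(2) by (metis list.set_intros(1) set_mset_mset)
  then obtain as bs where vs: "vs = as @ u # bs" by (meson split_list)
  have "f (as @ u # bs) = f (u # as @ bs)" if "mset (as @ u # bs) = mset (u # us)" for as bs
    using that
  proof (induction as arbitrary: bs rule: rev_induct)
    case (snoc z as)
    have "f ((as @ [z]) @ u # bs) = f (as @ u # z # bs)"
      using Cons.prems(1)[of as z u bs] snoc.prems by simp
    also have "\<dots> = f (u # as @ z # bs)" using snoc.IH[of "z # bs"] snoc.prems by simp
    finally show ?case by simp
  qed simp
  then have "f vs = f (u # as @ bs)" using Cons.prems(2) vs by simp
  also have "\<dots> = f (u # us)"
  proof (rule Cons.IH)
    show "mset (as @ bs) = mset us" using Cons.prems(2) vs by simp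
    show "f (u # a @ x # y # b) = f (u # a @ y # x # b)"
      if "mset (a @ x # y # b) = mset us" for a x y b
      using Cons.prems(1)[of "u # a" x y b] that by simp
  qed
  finally show ?case .
qed

text \<open>
  The entries of \<open>zs\<close> are distinct, so a sorting permutation is unique and the sign may be
  computed from any one at hand.
\<close>

lemma sorting_sign_eq:
  assumes "distinct es" "p permutes {..<length zs}" "permute_list p zs = es"
  shows "sorting_sign es zs = sign p"
proof -
  have dz: "distinct zs"
    using assms by (metis distinct_permute_list)
  have "q = p" if q: "q permutes {..<length zs}" "permute_list q zs = es" for q
  proof
    fix i
    show "q i = p i"
    proof (cases "i < length zs")
      case True
      have "zs ! q i = zs ! p i"
        using q assms(2,3) True by (metis permute_list_nth)
      moreover have "q i < length zs" "p i < length zs"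
        using True q(1) assms(2) by (metis lessThan_iff permutes_in_image)+
      ultimately show ?thesis using dz by (simp add: nth_eq_iff_index_eq)
    next
      case False
      then show ?thesis using q(1) assms(2) by (metis lessThan_iff permutes_not_in)
    qed
  qed
  then have "(THE q. q permutes {..<length zs} \<and> permute_list q zs = es) = p"
    using assms by blast
  then show ?thesis by (simp add: sorting_sign_def)
qed

lemma sorting_sign_swap:
  assumes es: "distinct es" and zs: "mset (a @ x # y # b) = mset es"
  shows "sorting_sign es (a @ x # y # b) = - sorting_sign es (a @ y # x # b)"
    and "sorting_sign es (a @ y # x # b) = 1 \<or> sorting_sign es (a @ y # x # b) = - 1"
proof -
  let ?zs = "a @ x # y # b" and ?zs' = "a @ y # x # b"
  let ?t = "transpose (length a) (Suc (length a))"
  have "mset es = mset ?zs'" using zs[symmetric] by (simp add: add_mset_commute)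
  then obtain q where q: "q permutes {..<length ?zs'}" "permute_list q ?zs' = es"
    by (rule mset_eq_permutation)
  have len: "length ?zs' = length ?zs" by simp
  have t: "?t permutes {..<length ?zs}" by (rule transpose_permutes_adjacent)
  have "permute_list (?t \<circ> q) ?zs = es"
    using q permute_list_compose[of q ?zs ?t] permute_list_adjacent[of a x y b] len by simp
  then have "sorting_sign es ?zs = sign (?t \<circ> q)"
    using sorting_sign_eq[OF es permutes_compose[OF q(1)[unfolded len] t]] by simp
  also have "\<dots> = sign ?t * sign q"
    using q(1) t by (meson finite_lessThan permutation_permutes sign_compose)
  also have "sign ?t = -1" by (simp add: sign_swap_id)
  also have "sign q = sorting_sign es ?zs'" using sorting_sign_eq[OF es q] by simp
  finally show "sorting_sign es ?zs = - sorting_sign es ?zs'" by simp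
  show "sorting_sign es ?zs' = 1 \<or> sorting_sign es ?zs' = - 1"
    using sorting_sign_eq[OF es q] by (auto simp: sign_def)
qed

lemma of_sign_sorting_sign_swap:
  assumes "distinct es" "mset (a @ x # y # b) = mset es"
  shows "(of_sign (sorting_sign es (a @ x # y # b)) :: 'f::idyll) =
    neg_one * of_sign (sorting_sign es (a @ y # x # b))"
  using sorting_sign_swap[OF assms] of_sign_uminus by metis

text \<open>
  Moving an entry past a block \<open>b\<close> takes \<open>length b\<close> adjacent swaps.
\<close>

lemma of_sign_sorting_sign_move:
  assumes es: "distinct es" and "mset (a @ x # b @ c) = mset es"
  shows "(of_sign (sorting_sign es (a @ x # b @ c)) :: 'f::idyll) =
    neg_one ^ length b * of_sign (sorting_sign es (a @ b @ x # c))"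
  using assms(2)
proof (induction b arbitrary: a)
  case (Cons y b)
  have "(of_sign (sorting_sign es (a @ x # y # b @ c)) :: 'f) =
      neg_one * of_sign (sorting_sign es ((a @ [y]) @ x # b @ c))"
    using of_sign_sorting_sign_swap[OF es, of a x y "b @ c"] Cons.prems by simp
  also have "\<dots> = neg_one * (neg_one ^ length b *
      of_sign (sorting_sign es ((a @ [y]) @ b @ x # c)))"
    using Cons.IH[of "a @ [y]"] Cons.prems by (simp add: add_mset_commute)
  finally show ?case by (simp add: mult.assoc)
qed simp

section \<open>Grassmann-Pluecker functions and their duals\<close>

lemma gp_nonzeroD:
  "grassmann_pluecker E r \<phi> \<Longrightarrow> \<phi> xs \<noteq> 0 \<Longrightarrow> distinct xs \<and> length xs = r \<and> set xs \<subseteq> E"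
  unfolding grassmann_pluecker_def tuples_def by blast

lemma gp_swap:
  assumes gp: "grassmann_pluecker E r \<phi>"
  shows "\<phi> (a @ x # y # b) = neg_one * \<phi> (a @ y # x # b)"
proof (cases "a @ y # x # b \<in> tuples E r")
  case True
  let ?t = "transpose (length a) (Suc (length a))"
  have t: "?t permutes {..<r}"
    using True transpose_permutes_adjacent[of a y x b] by (simp add: tuples_def)
  have "\<phi> (permute_list ?t (a @ y # x # b)) = of_sign (sign ?t) * \<phi> (a @ y # x # b)"
    using gp t True unfolding grassmann_pluecker_def by blast
  then show ?thesis
    by (simp only: permute_list_adjacent) (simp add: sign_swap_id of_sign_def)
next
  case False
  then have "a @ x # y # b \<notin> tuples E r" by (auto simp: tuples_def)
  then have "\<phi> (a @ x # y # b) = 0" "\<phi> (a @ y # x # b) = 0"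
    using gp False unfolding grassmann_pluecker_def by blast+
  then show ?thesis by simp
qed

lemma gp_nonzero_mset:
  assumes gp: "grassmann_pluecker E r \<phi>" and "mset vs = mset us"
  shows "\<phi> vs \<noteq> 0 \<longleftrightarrow> \<phi> us \<noteq> 0"
proof (rule adjacent_swap_invariant[OF _ assms(2), where f = "\<lambda>xs. \<phi> xs \<noteq> 0"])
  show "(\<phi> (a @ x # y # b) \<noteq> 0) = (\<phi> (a @ y # x # b) \<noteq> 0)" for a x y b
    by (subst gp_swap[OF gp]) (simp add: idyll_mult_zero_iff neg_one_nonzero)
qed

lemma fixed_order:
  assumes "finite E"
  shows "distinct (fixed_order E)" "set (fixed_order E) = E"
  using someI_ex[of "\<lambda>es. distinct es \<and> set es = E"] finite_distinct_list[OF assms]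
  unfolding fixed_order_def by blast+

lemma mset_eq_fixed_order:
  "finite E \<Longrightarrow> distinct zs \<Longrightarrow> set zs = E \<Longrightarrow> mset zs = mset (fixed_order E)"
  using fixed_order set_eq_iff_mset_eq_distinct by metis

text \<open>
  The dual function may be computed from any listing \<open>vs\<close> of the complement, not only from the
  ordered one: an adjacent swap in \<open>vs\<close> changes the signs of both factors.
\<close>

lemma dual_gp_eq:
  fixes \<phi> :: "'e list \<Rightarrow> 'f::idyll"
  assumes E: "finite E" and gp: "grassmann_pluecker E r \<phi>"
    and uv: "distinct (us @ vs)" "set (us @ vs) = E" "length vs = r"
  shows "dual_gp E r \<phi> us = of_sign (sorting_sign (fixed_order E) (us @ vs)) * \<phi> vs"
proof -
  let ?es = "fixed_order E"
  let ?vs = "filter (\<lambda>e. e \<notin> set us) ?es"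
  let ?f = "\<lambda>vs. of_sign (sorting_sign ?es (us @ vs)) * \<phi> vs"
  note es = fixed_order[OF E]
  have "card E = length us + r" using uv distinct_card[OF uv(1)] by simp
  then have "us \<in> tuples E (card E - r)" using uv by (auto simp: tuples_def)
  then have "dual_gp E r \<phi> us = ?f ?vs" using uv(1) by (simp add: dual_gp_def Let_def)
  also have "\<dots> = ?f vs"
  proof (rule adjacent_swap_invariant[where f = ?f])
    have "set ?vs = set vs" using es uv by auto
    then show vs: "mset ?vs = mset vs"
      using es uv by (metis distinct_append distinct_filter set_eq_iff_mset_eq_distinct)
    fix a x y b assume ab: "mset (a @ x # y # b) = mset vs"
    have "mset ((us @ a) @ x # y # b) = mset (us @ vs)" using ab by simp
    also have "\<dots> = mset ?es" using mset_eq_fixed_order[OF E uv(1,2)] .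
    finally have "mset ((us @ a) @ x # y # b) = mset ?es" .
    then have s: "(of_sign (sorting_sign ?es (us @ a @ x # y # b)) :: 'f) =
        neg_one * of_sign (sorting_sign ?es (us @ a @ y # x # b))"
      using of_sign_sorting_sign_swap[OF es(1), of "us @ a" x y b] by simp
    have "?f (a @ x # y # b) = (neg_one * neg_one) * ?f (a @ y # x # b)"
      unfolding s gp_swap[OF gp, of a x y b] by (simp only: mult.assoc mult.left_commute)
    then show "?f (a @ x # y # b) = ?f (a @ y # x # b)" by (simp add: neg_one_square)
  qed
  finally show ?thesis .
qed

text \<open>
  The entry \<open>zs ! j\<close> belongs to the complement of \<open>omit j zs\<close>.  Moving it from its place in \<open>zs\<close>
  to the front of \<open>ws\<close> takes \<open>length zs - 1 - j\<close> swaps; together with the \<open>j\<close>-th power of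
  \<open>-1\<close> in the definition of a circuit the sign no longer depends on \<open>j\<close>.
\<close>

lemma dual_gp_omit:
  fixes \<phi> :: "'e list \<Rightarrow> 'f::idyll"
  assumes E: "finite E" and gp: "grassmann_pluecker E r \<phi>"
    and zw: "distinct (zs @ ws)" "set (zs @ ws) = E" "Suc (length ws) = r" and j: "j < length zs"
  shows "neg_one ^ j * dual_gp E r \<phi> (omit j zs) =
    neg_one ^ (length zs - 1) * of_sign (sorting_sign (fixed_order E) (zs @ ws)) * \<phi> (zs ! j # ws)"
proof -
  let ?es = "fixed_order E"
  let ?a = "take j zs" and ?b = "drop (Suc j) zs"
  have zs: "zs = ?a @ zs ! j # ?b" using j by (rule id_take_nth_drop)
  let ?s = "of_sign (sorting_sign ?es (?a @ ?b @ zs ! j # ws)) :: 'f"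
  have "distinct ((?a @ zs ! j # ?b) @ ws)" "set ((?a @ zs ! j # ?b) @ ws) = E"
    using zw(1,2) zs by simp_all
  then have perm: "distinct ((?a @ ?b) @ zs ! j # ws)" "set ((?a @ ?b) @ zs ! j # ws) = E"
    by auto
  have dual: "dual_gp E r \<phi> (omit j zs) = ?s * \<phi> (zs ! j # ws)"
    using dual_gp_eq[OF E gp perm] zw(3) by (simp add: omit_def)
  have "mset (?a @ zs ! j # ?b @ ws) = mset ?es"
    using mset_eq_fixed_order[OF E zw(1,2)] zs by (metis append.assoc append_Cons)
  then have "(of_sign (sorting_sign ?es (zs @ ws)) :: 'f) = neg_one ^ length ?b * ?s"
    using of_sign_sorting_sign_move[OF fixed_order(1)[OF E], of ?a "zs ! j" ?b ws] zs
    by (metis append.assoc append_Cons)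
  moreover have "neg_one ^ length ?b * (neg_one ^ length ?b * ?s) = ?s"
    by (simp add: mult.assoc[symmetric] power_mult_distrib[symmetric] neg_one_square)
  ultimately have "?s = neg_one ^ length ?b * of_sign (sorting_sign ?es (zs @ ws))" by simp
  moreover have "neg_one ^ j * neg_one ^ length ?b = (neg_one :: 'f) ^ (length zs - 1)"
    using j by (simp add: power_add[symmetric])
  ultimately show ?thesis unfolding dual by (metis mult.assoc)
qed

section \<open>Circuits and cocircuits of matroids with coefficients\<close>

text \<open>
  All notions attached to a matroid with coefficients are studied through one chosen member of its
  class of Grassmann-Pluecker functions.
\<close>

definition represents :: "('e list \<Rightarrow> 'f::idyll) \<Rightarrow> ('e, 'f) fmatroid \<Rightarrow> bool" where
  "represents \<phi> M \<longleftrightarrow> finite (ground M) \<and> grassmann_pluecker (ground M) (frank M) \<phi> \<and>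
     gp_class M = {\<lambda>xs. a * \<phi> xs | a. a \<noteq> 0}"

lemma is_fmatroid_represents: "is_fmatroid M \<longleftrightarrow> (\<exists>\<phi>. represents \<phi> M)"
  by (auto simp: is_fmatroid_def represents_def)

lemma elements_underlying [simp]: "elements (underlying_matroid M) = ground M"
  by (simp add: underlying_matroid_def)

lemma represents_nonzeroD:
  "represents \<phi> M \<Longrightarrow> \<phi> xs \<noteq> 0 \<Longrightarrow> distinct xs \<and> length xs = frank M \<and> set xs \<subseteq> ground M"
  unfolding represents_def using gp_nonzeroD by blast

lemma bases_underlying:
  assumes "represents \<phi> M"
  shows "bases (underlying_matroid M) = {set xs | xs. \<phi> xs \<noteq> 0}"
proof -
  have cls: "gp_class M = {\<lambda>xs. a * \<phi> xs | a. a \<noteq> 0}"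
    using assms by (simp add: represents_def)
  have "(\<exists>\<psi>\<in>gp_class M. \<psi> xs \<noteq> 0) \<longleftrightarrow> \<phi> xs \<noteq> 0" for xs
    unfolding cls by (auto simp: idyll_mult_zero_iff intro: exI[of _ 1])
  then show ?thesis by (simp add: underlying_matroid_def)
qed

lemma basis_iff_nonzero:
  assumes \<phi>: "represents \<phi> M" and "distinct xs"
  shows "set xs \<in> bases (underlying_matroid M) \<longleftrightarrow> \<phi> xs \<noteq> 0"
proof
  assume "set xs \<in> bases (underlying_matroid M)"
  then obtain ys where ys: "\<phi> ys \<noteq> 0" "set xs = set ys"
    unfolding bases_underlying[OF \<phi>] by blast
  then have "mset xs = mset ys"
    using represents_nonzeroD[OF \<phi> ys(1)] assms(2) set_eq_iff_mset_eq_distinct by metis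
  then show "\<phi> xs \<noteq> 0" using \<phi> ys(1) gp_nonzero_mset unfolding represents_def by blast
qed (use bases_underlying[OF \<phi>] in blast)

text \<open>
  The function \<open>\<phi>\<close> is arbitrary so that the description applies to the dual as well, whose class
  consists of the multiples of a dual Grassmann-Pluecker function.
\<close>

lemma circuits_iff:
  assumes cls: "gp_class M = {\<lambda>xs. a * \<phi> xs | a. a \<noteq> 0}"
  shows "X \<in> circuits M \<longleftrightarrow> (\<exists>c ys. c \<noteq> 0 \<and> ys \<in> tuples (ground M) (Suc (frank M)) \<and> distinct ys \<and>
    (\<exists>k\<le>frank M. \<phi> (omit k ys) \<noteq> 0) \<and>
    (\<forall>i\<le>frank M. X (ys ! i) = c * (neg_one ^ i * \<phi> (omit i ys))) \<and> (\<forall>e. e \<notin> set ys \<longrightarrow> X e = 0))"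
    (is "_ \<longleftrightarrow> ?R")
proof
  assume "X \<in> circuits M"
  then obtain a b ys where *: "a \<noteq> 0" "b \<noteq> 0" "ys \<in> tuples (ground M) (Suc (frank M))" "distinct ys"
    "\<exists>k\<le>frank M. b * \<phi> (omit k ys) \<noteq> 0"
    "\<forall>i\<le>frank M. X (ys ! i) = a * (neg_one ^ i * (b * \<phi> (omit i ys)))"
    "\<forall>e. e \<notin> set ys \<longrightarrow> X e = 0"
    unfolding circuits_def cls by auto
  have "\<forall>i\<le>frank M. X (ys ! i) = (a * b) * (neg_one ^ i * \<phi> (omit i ys))"
    using *(6) by (metis mult.assoc mult.left_commute)
  moreover have "a * b \<noteq> 0" using *(1,2) by (simp add: idyll_mult_zero_iff)
  moreover have "\<exists>k\<le>frank M. \<phi> (omit k ys) \<noteq> 0" using *(5) by (auto simp: idyll_mult_zero_iff)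
  ultimately show ?R using *(3,4,7) by blast
next
  assume ?R
  moreover have "(\<lambda>xs. 1 * \<phi> xs) \<in> gp_class M"
    unfolding cls by (intro CollectI exI[of _ 1]) simp
  then have "\<phi> \<in> gp_class M" by simp
  ultimately show "X \<in> circuits M" unfolding circuits_def by blast
qed

lemma dual_gp_scale: "dual_gp E r (\<lambda>xs. b * \<phi> xs) xs = b * dual_gp E r \<phi> xs"
  by (simp add: dual_gp_def Let_def mult.left_commute)

text \<open>
  A circuit of the dual comes from a tuple \<open>zs\<close> of length \<open>n - r + 1\<close>.  Its complement is listed by
  a tuple \<open>ws\<close> of length \<open>r - 1\<close>, and by \<open>dual_gp_omit\<close> the value at \<open>zs ! j\<close> is
  \<open>\<phi> (zs ! j # ws)\<close> up to a factor \<open>?d\<close> independent of \<open>j\<close>.  At the remaining elements, the entries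
  of \<open>ws\<close> and those outside the ground set, both sides vanish.
\<close>

lemma cocircuits_iff:
  fixes \<phi> :: "'e list \<Rightarrow> 'f::idyll"
  assumes \<phi>: "represents \<phi> M"
  shows "Y \<in> cocircuits M \<longleftrightarrow> (\<exists>c ws. c \<noteq> 0 \<and> (\<exists>e. \<phi> (e # ws) \<noteq> 0) \<and> (\<forall>e. Y e = c * \<phi> (e # ws)))"
    (is "_ \<longleftrightarrow> ?R")
proof -
  let ?E = "ground M" and ?r = "frank M"
  let ?\<phi>' = "dual_gp ?E ?r \<phi>"
  have E: "finite ?E" and gp: "grassmann_pluecker ?E ?r \<phi>"
    and cls: "gp_class M = {\<lambda>xs. a * \<phi> xs | a. a \<noteq> 0}"
    using \<phi> by (simp_all add: represents_def)
  have dual_cls: "gp_class (dual M) = {\<lambda>xs. a * ?\<phi>' xs | a. a \<noteq> 0}"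
  proof -
    have "dual_gp ?E ?r ` {\<lambda>xs. a * \<phi> xs | a. a \<noteq> 0} = {dual_gp ?E ?r (\<lambda>xs. a * \<phi> xs) | a. a \<noteq> 0}"
      by blast
    then show ?thesis unfolding dual_def by (simp add: cls dual_gp_scale[abs_def])
  qed
  have dual_simps: "ground (dual M) = ?E" "frank (dual M) = card ?E - ?r"
    by (simp_all add: dual_def)
  have rank: "?r \<le> card ?E"
  proof -
    obtain xs where "\<phi> xs \<noteq> 0" using gp unfolding grassmann_pluecker_def by blast
    then have "distinct xs" "length xs = ?r" "set xs \<subseteq> ?E" using gp_nonzeroD[OF gp] by blast+
    then show ?thesis using card_mono[OF E, of "set xs"] distinct_card by metis
  qed
  show ?thesis
  proof
    assume "Y \<in> cocircuits M"
    then obtain c zs k where c: "c \<noteq> 0" and zs: "zs \<in> tuples ?E (Suc (card ?E - ?r))" "distinct zs"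
      and k: "k \<le> card ?E - ?r" "?\<phi>' (omit k zs) \<noteq> 0"
      and Y: "\<And>i. i \<le> card ?E - ?r \<Longrightarrow> Y (zs ! i) = c * (neg_one ^ i * ?\<phi>' (omit i zs))"
      and Y0: "\<And>e. e \<notin> set zs \<Longrightarrow> Y e = 0"
      unfolding cocircuits_def circuits_iff[OF dual_cls] dual_simps by blast
    obtain ws where ws: "set ws = ?E - set zs" "distinct ws"
      using finite_distinct_list[of "?E - set zs"] E by auto
    have zs': "set zs \<subseteq> ?E" "length zs = Suc (card ?E - ?r)" using zs by (auto simp: tuples_def)
    have zw: "distinct (zs @ ws)" "set (zs @ ws) = ?E" using zs zs' ws by auto
    then have "length zs + length ws = card ?E" using distinct_card by fastforce
    then have len: "Suc (length ws) = ?r" using zs' rank by linarith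
    let ?d = "neg_one ^ (length zs - 1) * of_sign (sorting_sign (fixed_order ?E) (zs @ ws)) :: 'f"
    have d: "?d \<noteq> 0" by (simp add: idyll_mult_zero_iff neg_one_power_nonzero of_sign_nonzero)
    have omit: "neg_one ^ j * ?\<phi>' (omit j zs) = ?d * \<phi> (zs ! j # ws)" if "j < length zs" for j
      using dual_gp_omit[OF E gp zw len that] .
    have "Y e = (c * ?d) * \<phi> (e # ws)" for e
    proof (cases "e \<in> set zs")
      case True
      then obtain j where "j < length zs" "e = zs ! j" by (metis in_set_conv_nth)
      then show ?thesis using Y[of j] omit zs' by (simp add: mult.assoc)
    next
      case False
      then have "\<phi> (e # ws) = 0" using gp_nonzeroD[OF gp, of "e # ws"] ws(1) by auto
      then show ?thesis using Y0 False by simp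
    qed
    moreover have "\<phi> (zs ! k # ws) \<noteq> 0"
    proof -
      have "neg_one ^ k * ?\<phi>' (omit k zs) \<noteq> 0"
        using k by (simp add: idyll_mult_zero_iff neg_one_power_nonzero)
      then show ?thesis using omit[of k] k zs' by (auto simp: idyll_mult_zero_iff)
    qed
    moreover have "c * ?d \<noteq> 0" using c d by (simp add: idyll_mult_zero_iff)
    ultimately show ?R by blast
  next
    assume ?R
    then obtain c ws e where c: "c \<noteq> 0" and e: "\<phi> (e # ws) \<noteq> 0" and Y: "\<And>x. Y x = c * \<phi> (x # ws)"
      by blast
    have ew: "distinct (e # ws)" "Suc (length ws) = ?r" "set (e # ws) \<subseteq> ?E"
      using gp_nonzeroD[OF gp e] by simp_all
    obtain zs where zs: "set zs = ?E - set ws" "distinct zs"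
      using finite_distinct_list[of "?E - set ws"] E by auto
    have zw: "distinct (zs @ ws)" "set (zs @ ws) = ?E" using zs ew by auto
    then have "length zs + length ws = card ?E" using distinct_card by fastforce
    then have len: "length zs = Suc (card ?E - ?r)" using ew rank by linarith
    let ?d = "neg_one ^ (length zs - 1) * of_sign (sorting_sign (fixed_order ?E) (zs @ ws)) :: 'f"
    have d: "?d \<noteq> 0" by (simp add: idyll_mult_zero_iff neg_one_power_nonzero of_sign_nonzero)
    then obtain d' where d': "?d * d' = 1" using unit_inverse by blast
    have omit: "neg_one ^ j * ?\<phi>' (omit j zs) = ?d * \<phi> (zs ! j # ws)" if "j < length zs" for j
      using dual_gp_omit[OF E gp zw ew(2) that] .
    have "e \<in> set zs" using zs ew by auto
    then obtain k where k: "k < length zs" "e = zs ! k" by (metis in_set_conv_nth)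
    have "?d * \<phi> (zs ! k # ws) \<noteq> 0" using d e k by (simp add: idyll_mult_zero_iff)
    then have "?\<phi>' (omit k zs) \<noteq> 0"
      using omit[OF k(1)] by (auto simp: idyll_mult_zero_iff)
    moreover have "d' \<noteq> 0" using d' by force
    then have "c * d' \<noteq> 0" using c by (simp add: idyll_mult_zero_iff)
    moreover have "Y (zs ! i) = (c * d') * (neg_one ^ i * ?\<phi>' (omit i zs))"
      if "i \<le> card ?E - ?r" for i
    proof -
      have "(c * d') * (?d * \<phi> (zs ! i # ws)) = c * (?d * d') * \<phi> (zs ! i # ws)"
        by (simp only: mult.assoc mult.left_commute)
      then show ?thesis using omit[of i] that len d' Y by simp
    qed
    moreover have "Y x = 0" if "x \<notin> set zs" for x
    proof -
      have "\<phi> (x # ws) = 0" using gp_nonzeroD[OF gp, of "x # ws"] that zs(1) by auto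
      then show ?thesis using Y by simp
    qed
    moreover have "zs \<in> tuples ?E (Suc (card ?E - ?r))" using len zs by (auto simp: tuples_def)
    moreover have "k \<le> card ?E - ?r" using k len by simp
    ultimately show "Y \<in> cocircuits M"
      unfolding cocircuits_def circuits_iff[OF dual_cls] dual_simps using zs(2) by blast
  qed
qed

text \<open>
  For a circuit coming from \<open>ys\<close> and a cocircuit coming from \<open>ws\<close>, the pairing is, up to the unit
  \<open>a * c\<close>, the Grassmann-Pluecker relation for \<open>ys\<close> and \<open>ws\<close>.
\<close>

lemma circuits_subset_vectors:
  fixes M :: "('e, 'f::idyll) fmatroid"
  assumes "is_fmatroid M"
  shows "circuits M \<subseteq> vectors M"
proof
  fix X assume "X \<in> circuits M"
  obtain \<phi> where \<phi>: "represents \<phi> M" using assms is_fmatroid_represents by blast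
  let ?E = "ground M" and ?r = "frank M"
  have E: "finite ?E" and gp: "grassmann_pluecker ?E ?r \<phi>"
    and cls: "gp_class M = {\<lambda>xs. a * \<phi> xs | a. a \<noteq> 0}"
    using \<phi> by (simp_all add: represents_def)
  obtain a ys where a: "a \<noteq> 0" and ys: "ys \<in> tuples ?E (Suc ?r)" "distinct ys"
    and X: "\<And>i. i \<le> ?r \<Longrightarrow> X (ys ! i) = a * (neg_one ^ i * \<phi> (omit i ys))"
    and X0: "\<And>e. e \<notin> set ys \<Longrightarrow> X e = 0"
    using \<open>X \<in> circuits M\<close> unfolding circuits_iff[OF cls] by blast
  have ys': "set ys \<subseteq> ?E" "length ys = Suc ?r" using ys by (auto simp: tuples_def)
  have "orthogonal ?E X Y" if coc: "Y \<in> cocircuits M" for Y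
  proof -
    obtain c e ws where c: "c \<noteq> 0" and e: "\<phi> (e # ws) \<noteq> 0" and Y: "\<And>x. Y x = c * \<phi> (x # ws)"
      using coc unfolding cocircuits_iff[OF \<phi>] by blast
    have ws: "Suc (length ws) = ?r" "set ws \<subseteq> ?E" using gp_nonzeroD[OF gp e] by simp_all
    let ?t = "\<lambda>i. neg_one ^ i * \<phi> (omit i ys) * \<phi> (ys ! i # ws)"
    have "formal_sum (\<lambda>e. X e * Y e) ?E = formal_sum (\<lambda>e. X e * Y e) (set ys)"
      using E ys' X0 by (intro formal_sum_mono_neutral) auto
    also have "\<dots> = formal_sum (\<lambda>i. X (ys ! i) * Y (ys ! i)) {0..?r}"
    proof -
      have "bij_betw ((!) ys) {0..?r} (set ys)"
        using ys(2) ys'(2) by (intro bij_betw_nth) auto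
      then show ?thesis unfolding formal_sum_def by (rule sum.reindex_bij_betw[symmetric])
    qed
    also have "\<dots> = formal_sum (\<lambda>i. (a * c) * ?t i) {0..?r}"
      unfolding formal_sum_def
    proof (rule sum.cong[OF refl])
      fix i assume "i \<in> {0..?r}"
      then have "X (ys ! i) * Y (ys ! i) = (a * c) * ?t i"
        by (simp add: X Y mult.assoc mult.left_commute)
      then show "formal_elem (X (ys ! i) * Y (ys ! i)) = formal_elem ((a * c) * ?t i)" by simp
    qed
    also have "\<dots> = formal_times {#a * c#} (formal_sum ?t {0..?r})"
      using a c by (intro formal_sum_scale) (simp add: idyll_mult_zero_iff)
    also have "\<dots> \<in> nullset"
    proof (rule nullset_times)
      show "0 \<notin># {#a * c#}" using a c by (simp add: idyll_mult_zero_iff)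
      show "formal_sum ?t {0..?r} \<in> nullset"
        using gp ws ys(1) unfolding grassmann_pluecker_def by blast
    qed
    finally show ?thesis by (simp add: orthogonal_def)
  qed
  moreover have "X \<in> tuple_space ?E" using X0 ys' by (auto simp: tuple_space_def)
  ultimately show "X \<in> vectors M" by (simp add: vectors_def)
qed

text \<open>
  For a listing \<open>bs\<close> of the basis, the circuit of the tuple \<open>e # bs\<close> works: omitting an entry
  \<open>x\<close> leaves a tuple with nonzero value exactly if \<open>insert e B - {x}\<close> is a basis.
\<close>

lemma fund_circuit_support:
  fixes M :: "('e, 'f::idyll) fmatroid"
  assumes "is_fmatroid M" and B: "B \<in> bases (underlying_matroid M)" and e: "e \<in> ground M - B"
  obtains X where "X \<in> circuits M" "{x. X x \<noteq> 0} = fund_circuit (underlying_matroid M) B e"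
proof -
  obtain \<phi> where \<phi>: "represents \<phi> M" using assms is_fmatroid_represents by blast
  have cls: "gp_class M = {\<lambda>xs. a * \<phi> xs | a. a \<noteq> 0}" using \<phi> by (simp add: represents_def)
  obtain bs where bs: "B = set bs" "\<phi> bs \<noteq> 0" using B unfolding bases_underlying[OF \<phi>] by blast
  note bs' = represents_nonzeroD[OF \<phi> bs(2)]
  let ?ys = "e # bs"
  have ys: "distinct ?ys" "?ys \<in> tuples (ground M) (Suc (frank M))"
    using bs' bs(1) e by (auto simp: tuples_def)
  define X where "X x = (if x \<in> set ?ys
    then let i = (THE i. i < length ?ys \<and> ?ys ! i = x) in neg_one ^ i * \<phi> (omit i ?ys) else 0)" for x
  have X: "X (?ys ! i) = neg_one ^ i * \<phi> (omit i ?ys)" if "i < length ?ys" for i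
  proof -
    have "(THE j. j < length ?ys \<and> ?ys ! j = ?ys ! i) = i"
      using that ys(1) nth_eq_iff_index_eq by (intro the_equality) blast+
    then show ?thesis unfolding X_def using that nth_mem[of i ?ys] by (simp only: Let_def if_True)
  qed
  have "X \<in> circuits M"
    unfolding circuits_iff[OF cls]
  proof (intro exI conjI)
    show "(1::'f) \<noteq> 0" "distinct ?ys" "?ys \<in> tuples (ground M) (Suc (frank M))" using ys by simp_all
    show "0 \<le> frank M" "\<phi> (omit 0 ?ys) \<noteq> 0" using bs(2) by (simp_all add: omit_def)
    show "\<forall>i\<le>frank M. X (?ys ! i) = 1 * (neg_one ^ i * \<phi> (omit i ?ys))"
      using X bs' by simp
    show "\<forall>x. x \<notin> set ?ys \<longrightarrow> X x = 0" by (simp add: X_def)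
  qed
  moreover have "{x. X x \<noteq> 0} = fund_circuit (underlying_matroid M) B e"
  proof -
    have "X x \<noteq> 0 \<longleftrightarrow> set ?ys - {x} \<in> bases (underlying_matroid M)" if x: "x \<in> set ?ys" for x
    proof -
      obtain i where i: "i < length ?ys" "x = ?ys ! i" using x by (metis in_set_conv_nth)
      have split: "?ys = take i ?ys @ x # drop (Suc i) ?ys" using i id_take_nth_drop by metis
      then have "distinct (take i ?ys @ x # drop (Suc i) ?ys)" using ys(1) by metis
      then have "distinct (omit i ?ys)" "x \<notin> set (omit i ?ys)" by (auto simp: omit_def)
      moreover have "set ?ys = insert x (set (omit i ?ys))"
        by (subst split) (simp add: omit_def)
      ultimately have "set ?ys - {x} \<in> bases (underlying_matroid M) \<longleftrightarrow> \<phi> (omit i ?ys) \<noteq> 0"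
        using basis_iff_nonzero[OF \<phi>] by simp
      then show ?thesis using X[OF i(1)] i(2) by (simp add: idyll_mult_zero_iff neg_one_power_nonzero)
    qed
    moreover have "X x = 0" if "x \<notin> set ?ys" for x using that by (simp add: X_def)
    ultimately show ?thesis unfolding fund_circuit_def bs(1) by auto
  qed
  ultimately show thesis using that by blast
qed

lemma cocircuit_support_of_list:
  assumes \<phi>: "represents \<phi> M" and e: "\<phi> (e # ws) \<noteq> 0"
  shows "{x. \<phi> (x # ws) \<noteq> 0} = fund_cocircuit (underlying_matroid M) (set (e # ws)) e"
proof -
  have d: "distinct (e # ws)" using represents_nonzeroD[OF \<phi> e] by blast
  then have "set (e # ws) - {e} = set ws" by auto
  moreover have "\<phi> (x # ws) \<noteq> 0 \<longleftrightarrow> insert x (set ws) \<in> bases (underlying_matroid M)" for x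
  proof (cases "x \<in> set ws")
    case False
    then show ?thesis using basis_iff_nonzero[OF \<phi>, of "x # ws"] d by simp
  next
    case True
    then have "\<phi> (x # ws) = 0" using represents_nonzeroD[OF \<phi>, of "x # ws"] by auto
    moreover have "\<phi> ws = 0"
      using represents_nonzeroD[OF \<phi>, of ws] represents_nonzeroD[OF \<phi> e] by auto
    then have "set ws \<notin> bases (underlying_matroid M)" using basis_iff_nonzero[OF \<phi>, of ws] d by simp
    ultimately show ?thesis using True by (simp add: insert_absorb)
  qed
  ultimately show ?thesis by (simp add: fund_cocircuit_def)
qed

lemma fund_cocircuit_support:
  fixes M :: "('e, 'f::idyll) fmatroid"
  assumes "is_fmatroid M" and B: "B \<in> bases (underlying_matroid M)" "e \<in> B"
  obtains Y where "Y \<in> cocircuits M" "{x. Y x \<noteq> 0} = fund_cocircuit (underlying_matroid M) B e"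
proof -
  obtain \<phi> where \<phi>: "represents \<phi> M" using assms is_fmatroid_represents by blast
  obtain bs where bs: "B = set bs" "\<phi> bs \<noteq> 0" using B(1) unfolding bases_underlying[OF \<phi>] by blast
  have "mset (e # remove1 e bs) = mset bs" using B(2) bs(1) by simp
  then have e: "\<phi> (e # remove1 e bs) \<noteq> 0" "set (e # remove1 e bs) = B"
    using \<phi> bs gp_nonzero_mset mset_eq_setD unfolding represents_def by metis+
  have "(\<lambda>x. \<phi> (x # remove1 e bs)) \<in> cocircuits M"
    unfolding cocircuits_iff[OF \<phi>] using e(1)
    by (intro exI[of _ 1] exI[of _ "remove1 e bs"]) auto
  then show thesis using that cocircuit_support_of_list[OF \<phi> e(1)] e(2) by simp
qed

lemma cocircuit_support:
  fixes M :: "('e, 'f::idyll) fmatroid"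
  assumes "is_fmatroid M" and Y: "Y \<in> cocircuits M"
  obtains B e where "B \<in> bases (underlying_matroid M)" "e \<in> B"
    "{x. Y x \<noteq> 0} = fund_cocircuit (underlying_matroid M) B e"
proof -
  obtain \<phi> where \<phi>: "represents \<phi> M" using assms is_fmatroid_represents by blast
  obtain c e ws where c: "c \<noteq> 0" and e: "\<phi> (e # ws) \<noteq> 0" and Y: "\<And>x. Y x = c * \<phi> (x # ws)"
    using Y unfolding cocircuits_iff[OF \<phi>] by blast
  have "{x. Y x \<noteq> 0} = {x. \<phi> (x # ws) \<noteq> 0}" using c Y by (simp add: idyll_mult_zero_iff)
  moreover have "set (e # ws) \<in> bases (underlying_matroid M)"
    using e bases_underlying[OF \<phi>] by blast
  ultimately show thesis using that cocircuit_support_of_list[OF \<phi> e] by auto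
qed

section \<open>Orthogonality and supports\<close>

lemma orthogonal_card_neq_1:
  fixes X Y :: "'e \<Rightarrow> 'f::idyll"
  assumes "finite E" "orthogonal E X Y"
  shows "card {e \<in> E. X e \<noteq> 0 \<and> Y e \<noteq> 0} \<noteq> 1"
proof
  assume "card {e \<in> E. X e \<noteq> 0 \<and> Y e \<noteq> 0} = 1"
  then have "size (formal_sum (\<lambda>e. X e * Y e) E) = 1"
    using size_formal_sum[OF assms(1), of "\<lambda>e. X e * Y e"] by (simp add: idyll_mult_zero_iff)
  then obtain a where "formal_sum (\<lambda>e. X e * Y e) E = {#a#}" using size_1_singleton_mset by blast
  then show False using assms(2) singleton_notin_nullset unfolding orthogonal_def by metis
qed

lemma krasner_orthogonal_iff:
  fixes X Y :: "'e \<Rightarrow> krasner"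
  assumes "finite E"
  shows "orthogonal E X Y \<longleftrightarrow> card {e \<in> E. X e \<noteq> 0 \<and> Y e \<noteq> 0} \<noteq> 1"
  using size_formal_sum[OF assms, of "\<lambda>e. X e * Y e"] zero_notin_formal_sum[OF assms]
  unfolding orthogonal_def nullset_krasner_def idyll_mult_nonzero by auto

section \<open>Morphisms and strong maps\<close>

text \<open>
  A circuit leaving the preimage of a flat in one element only would be mapped to a vector that
  meets some cocircuit in one position only.
\<close>

lemma fmorphism_imp_strong_map:
  fixes N :: "('s, 'f::idyll) fmatroid" and M :: "('t, 'f) fmatroid"
  assumes N: "is_fmatroid N" and M: "is_fmatroid M" and mor: "fmorphism \<Phi> N M"
  shows "strong_map (underlying_map (ground M) (ground N) \<Phi>) (underlying_matroid N) (underlying_matroid M)"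
proof -
  let ?S = "ground N" and ?T = "ground M"
  let ?N = "underlying_matroid N" and ?M = "underlying_matroid M"
  have uN: "is_matroid ?N" and uM: "is_matroid ?M"
    using N M underlying_is_matroid by blast+
  have S: "finite ?S" and T: "finite ?T" using N M by (simp_all add: is_fmatroid_def)
  have \<Phi>: "submonomial ?T ?S \<Phi>" using mor by (simp add: fmorphism_def)
  have "flat ?N (preimage ?T ?S \<Phi> A)" if A: "flat ?M A" for A
  proof (rule ccontr)
    assume "\<not> ?thesis"
    moreover have "preimage ?T ?S \<Phi> A \<subseteq> elements ?N" by (auto simp: preimage_def)
    ultimately obtain B e where B: "B \<in> bases ?N" and e: "e \<in> elements ?N - preimage ?T ?S \<Phi> A" "e \<notin> B"
      and C: "fund_circuit ?N B e \<subseteq> insert e (preimage ?T ?S \<Phi> A)"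
      using not_flat_fund_circuit[OF uN] by metis
    have eC: "e \<in> fund_circuit ?N B e" using B e(2) by (simp add: fund_circuit_def)
    obtain i where i: "i \<in> ?T" "\<Phi> i e \<noteq> 0" "i \<notin> A" using e(1) by (auto simp: preimage_def)
    obtain X where X: "X \<in> circuits N" "{x. X x \<noteq> 0} = fund_circuit ?N B e"
      using fund_circuit_support[OF N B] e by auto
    have "i \<in> elements ?M - A" using i by simp
    then obtain B' where B': "B' \<in> bases ?M" "i \<in> B'" "fund_cocircuit ?M B' i \<inter> A = {}"
      using flat_avoided_by_fund_cocircuit[OF uM A] by blast
    obtain Y where Y: "Y \<in> cocircuits M" "{x. Y x \<noteq> 0} = fund_cocircuit ?M B' i"
      using fund_cocircuit_support[OF M B'(1,2)] .
    let ?Z = "mat_apply ?T ?S \<Phi> X"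
    have "?Z \<in> vectors M"
      using mor X(1) circuits_subset_vectors[OF N] by (auto simp: fmorphism_def)
    then have "orthogonal ?T ?Z Y" using Y(1) by (simp add: vectors_def)
    \<comment> \<open>A common position \<open>k\<close> lies outside \<open>A\<close>, so it is the image of a circuit element outside the
       preimage of \<open>A\<close>; the only such element is \<open>e\<close>.\<close>
    moreover have "{k \<in> ?T. ?Z k \<noteq> 0 \<and> Y k \<noteq> 0} = {i}"
    proof -
      have "k = i" if k: "k \<in> ?T" "?Z k \<noteq> 0" "Y k \<noteq> 0" for k
      proof -
        obtain j where j: "j \<in> ?S" "\<Phi> k j \<noteq> 0" "X j \<noteq> 0"
          using k(2) mat_apply_nonzero[OF \<Phi> S] by blast
        have "k \<notin> A" using k(3) Y(2) B'(3) by blast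
        then have "j \<notin> preimage ?T ?S \<Phi> A" using j k(1) by (auto simp: preimage_def)
        then have "j = e" using j(3) X(2) C by blast
        then show ?thesis using \<Phi> j k(1) i unfolding submonomial_def by blast
      qed
      moreover have "?Z i \<noteq> 0"
        using mat_apply_nonzero[OF \<Phi> S, of X i] i e(1) eC X(2) by auto
      moreover have "Y i \<noteq> 0"
      proof -
        have "i \<in> fund_cocircuit ?M B' i" using B' by (simp add: fund_cocircuit_def insert_absorb)
        then show ?thesis using Y(2) by blast
      qed
      ultimately show ?thesis using i(1) by blast
    qed
    ultimately show False using orthogonal_card_neq_1[OF T] by fastforce
  qed
  then show ?thesis
    using strong_map_underlying_map[of ?M ?N \<Phi>] \<Phi> by simp
qed

text \<open>
  Over the Krasner hyperfield a failure of orthogonality is a single common position.  Pulling back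
  the flat that complements the cocircuit carries this failure from \<open>\<Phi> \<cdot> X\<close> back to \<open>X\<close>.
\<close>

lemma krasner_strong_map_imp_fmorphism:
  fixes N :: "('s, krasner) fmatroid" and M :: "('t, krasner) fmatroid"
  assumes N: "is_fmatroid N" and M: "is_fmatroid M" and \<Phi>: "submonomial (ground M) (ground N) \<Phi>"
    and strong: "strong_map (underlying_map (ground M) (ground N) \<Phi>)
      (underlying_matroid N) (underlying_matroid M)"
  shows "fmorphism \<Phi> N M"
proof -
  let ?S = "ground N" and ?T = "ground M"
  let ?N = "underlying_matroid N" and ?M = "underlying_matroid M"
  have uN: "is_matroid ?N" and uM: "is_matroid ?M"
    using N M underlying_is_matroid by blast+
  have S: "finite ?S" and T: "finite ?T" using N M by (simp_all add: is_fmatroid_def)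
  have "mat_apply ?T ?S \<Phi> X \<in> vectors M" if X: "X \<in> vectors N" for X
  proof -
    let ?Z = "mat_apply ?T ?S \<Phi> X"
    have "orthogonal ?T ?Z Y" if Y: "Y \<in> cocircuits M" for Y
    proof (rule ccontr)
      assume "\<not> ?thesis"
      then have "card {i \<in> ?T. ?Z i \<noteq> 0 \<and> Y i \<noteq> 0} = 1" using krasner_orthogonal_iff[OF T] by blast
      then obtain i where i: "{i \<in> ?T. ?Z i \<noteq> 0 \<and> Y i \<noteq> 0} = {i}" by (rule card_1_singletonE)
      then have iT: "i \<in> ?T" "?Z i \<noteq> 0" "Y i \<noteq> 0" by blast+
      then obtain j where j: "j \<in> ?S" "\<Phi> i j \<noteq> 0" "X j \<noteq> 0"
        using mat_apply_nonzero[OF \<Phi> S] by blast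
      obtain B e where "B \<in> bases ?M" "e \<in> B" "{x. Y x \<noteq> 0} = fund_cocircuit ?M B e"
        using cocircuit_support[OF M Y] .
      then have "flat ?M (?T - {x. Y x \<noteq> 0})"
        using flat_Compl_fund_cocircuit[OF uM] by simp
      then have flat: "flat ?N (preimage ?T ?S \<Phi> (?T - {x. Y x \<noteq> 0}))" (is "flat ?N ?Q")
        using strong strong_map_underlying_map[of ?M ?N \<Phi>] \<Phi> by simp
      have "j \<in> elements ?N - ?Q" using j iT by (auto simp: preimage_def)
      then obtain B' where B': "B' \<in> bases ?N" "j \<in> B'" "fund_cocircuit ?N B' j \<inter> ?Q = {}"
        using flat_avoided_by_fund_cocircuit[OF uN flat] by blast
      obtain Y' where Y': "Y' \<in> cocircuits N" "{x. Y' x \<noteq> 0} = fund_cocircuit ?N B' j"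
        using fund_cocircuit_support[OF N B'(1,2)] .
      have "orthogonal ?S X Y'" using X Y'(1) by (simp add: vectors_def)
      \<comment> \<open>Another common position \<open>k\<close> would be mapped into the support of \<open>Y\<close>, hence to \<open>i\<close>, but the
         row \<open>i\<close> of \<open>\<Phi>\<close> is nonzero only in column \<open>j\<close>.\<close>
      moreover have "{k \<in> ?S. X k \<noteq> 0 \<and> Y' k \<noteq> 0} = {j}"
      proof -
        have "k = j" if k: "k \<in> ?S" "X k \<noteq> 0" "Y' k \<noteq> 0" for k
        proof -
          have "k \<notin> ?Q" using k(3) Y'(2) B'(3) by blast
          then obtain l where l: "l \<in> ?T" "\<Phi> l k \<noteq> 0" "Y l \<noteq> 0"
            using k(1) by (auto simp: preimage_def)
          then have "?Z l \<noteq> 0" using mat_apply_nonzero[OF \<Phi> S] k by blast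
          then have "l = i" using i l by blast
          then show ?thesis using \<Phi> l k(1) j iT(1) unfolding submonomial_def by blast
        qed
        moreover have "j \<in> fund_cocircuit ?N B' j"
          using B' by (simp add: fund_cocircuit_def insert_absorb)
        then have "Y' j \<noteq> 0" using Y'(2) by blast
        ultimately show ?thesis using j by blast
      qed
      ultimately show False using orthogonal_card_neq_1[OF S] by fastforce
    qed
    moreover have "?Z \<in> tuple_space ?T" by (simp add: tuple_space_def mat_apply_def)
    ultimately show ?thesis by (simp add: vectors_def)
  qed
  then show ?thesis using \<Phi> by (auto simp: fmorphism_def)
qed

theorem propositionC:
  shows "(\<forall>(N :: ('s, krasner) fmatroid) (M :: ('t, krasner) fmatroid) (\<Phi> :: 't \<Rightarrow> 's \<Rightarrow> krasner).
            is_fmatroid N \<and> is_fmatroid M \<and> submonomial (ground M) (ground N) \<Phi> \<longrightarrow>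
            (fmorphism \<Phi> N M \<longleftrightarrow>
             strong_map (underlying_map (ground M) (ground N) \<Phi>)
               (underlying_matroid N) (underlying_matroid M)))
       \<and> (perfect_idyll TYPE('f::idyll) \<longrightarrow>
          (\<forall>(N :: ('s, 'f) fmatroid) (M :: ('t, 'f) fmatroid) (\<Phi> :: 't \<Rightarrow> 's \<Rightarrow> 'f).
            is_fmatroid N \<and> is_fmatroid M \<and> fmorphism \<Phi> N M \<longrightarrow>
            strong_map (underlying_map (ground M) (ground N) \<Phi>)
               (underlying_matroid N) (underlying_matroid M)))"
  by (intro conjI allI impI iffI; elim conjE)
    (assumption | rule fmorphism_imp_strong_map krasner_strong_map_imp_fmorphism)+

end
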